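(* Assume that $g$ is $\gamma_g$-strongly convex with $\gamma_g>0$. Let $\{(z_n,x_n,y_n,\beta_n,\tau_n): n\ge1\}$ be the sequence generated by the accelerated GRPDA with linesearch (defined in the context), and let $x^*$ denote the unique primal optimal solution (so that every element of $\Omega$ has the form $(x^*,\bar y)$). Then: (a) there exist constants $C_1,C_2>0$ such that $\|z_{n+1}-x^*\|\le C_1/n$ and $\|x_{n+1}-x^*\|\le C_2/n$ for all $n\ge1$; (b) the sequence $\{y_n:n\ge1\}$ is bounded, and it has a subsequence converging to some $y^*$ such that $(x^*,y^* )$ is a solution of $\min_{x\in\mathbb{R}^q}\max_{y\in\mathbb{R}^p}\mathcal{L}(x,y)$, i.e., $(x^*,y^* )\in\Omega$; (c) for any $(\bar x,\bar y)\in\Omega$ with associated primal-dual gap function $G$, there exists a constant $C_3>0$ such that $G(X_N,Y_N)\le C_3/N^2$ for every integer $N\ge1$, where $$S_N=\sum_{n=1}^N\beta_n\tau_n,\qquad X_N=\frac1{S_N}\sum_{n=1}^N\beta_n\tau_n x_n,\qquad Y_N=\frac1{S_N}\sum_{n=1}^N\beta_n\tau_n y_n.$$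
   Context: Setting. $\mathbb{R}^p,\mathbb{R}^q$ are finite-dimensional Euclidean spaces with inner product $\langle\cdot,\cdot\rangle$ and induced norm $\|\cdot\|$; $f:\mathbb{R}^p\to(-\infty,+\infty]$ and $g:\mathbb{R}^q\to(-\infty,+\infty]$ are closed proper convex functions; $K\in\mathbb{R}^{p\times q}$ is a linear map from $\mathbb{R}^q$ to $\mathbb{R}^p$ with adjoint $K^\top$; $f^*(y)=\sup_{x}\{\langle y,x\rangle-f(x)\}$ is the Legendre-Fenchel conjugate. Put $\mathcal{L}(x,y)=g(x)+\langle Kx,y\rangle-f^*(y)$. Standing assumption: the set of minimizers of $\min_{x\in\mathbb{R}^q} g(x)+f(Kx)$ is nonempty, and there is $\tilde x\in \mathrm{ri}(\mathrm{dom}(g))$ with $K\tilde x\in \mathrm{ri}(\mathrm{dom}(f))$ (ri denotes relative interior, dom the effective domain). The solution set of the saddle point problem is $\Omega=\{(\bar x,\bar y)\in\mathbb{R}^q\times\mathbb{R}^p: 0\in\partial g(\bar x)+K^\top\bar y,\ 0\in\partial f^*(\bar y)-K\bar x\}$. For $(\bar x,\bar y)\in\Omega$, the primal-dual gap function is $G(x,y)=\mathcal{L}(x,\bar y)-\mathcal{L}(\bar x,y)=P(x)+D(y)\ge0$, where $P(x)=g(x)-g(\bar x)+\langle K^\top\bar y,x-\bar x\rangle$ and $D(y)=f^*(y)-f^*(\bar y)-\langle K\bar x,y-\bar y\rangle$. $g$ is $\gamma_g$-strongly convex if $g(y)\ge g(x)+\langle u,y-x\rangle+\frac{\gamma_g}{2}\|y-x\|^2$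 for all $x,y\in\mathbb{R}^q$ and $u\in\partial g(x)$. For $\lambda>0$ and closed proper convex $h$, $\mathrm{Prox}_{\lambda h}(x)=\arg\min_y\{h(y)+\frac{1}{2\lambda}\|y-x\|^2\}$. Let $\phi=\frac{\sqrt5+1}{2}$. Accelerated GRPDA with linesearch. Let $\psi_0=1.3247\ldots$ be the unique real root of $\psi^3-\psi-1=0$. Choose $\psi\in(\psi_0,\phi)$, $\beta_0>0$, $\tau_0>0$, $\mu\in(0,1)$, $x_0=z_0\in\mathbb{R}^q$, $y_0\in\mathbb{R}^p$; set $\varphi=\frac{1+\psi}{\psi^2}$ (then $\psi>\varphi$). For $n=1,2,\ldots$: (1) $z_n=\frac{\psi-1}{\psi}x_{n-1}+\frac1\psi z_{n-1}$, $x_n=\mathrm{Prox}_{\tau_{n-1}g}(z_n-\tau_{n-1}K^\top y_{n-1})$, $\omega_n=\frac{\psi-\varphi}{\psi+\varphi\gamma_g\tau_{n-1}}$, $\beta_n=\beta_{n-1}(1+\gamma_g\omega_n\tau_{n-1})$; (2) (linesearch) $y_n=\mathrm{Prox}_{\beta_n\tau_n f^*}(y_{n-1}+\beta_n\tau_n Kx_n)$, where $\tau_n=\varphi\tau_{n-1}\mu^i$ and $i$ is the smallest nonnegative integer such that, with this $\tau_n$ and the corresponding $y_n$, $\sqrt{\beta_n\tau_n}\,\|K^\top y_n-K^\top y_{n-1}\|\le\sqrt{\psi/\tau_{n-1}}\,\|y_n-y_{n-1}\|$. (Such an $i$ always exists.) *)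

theory Defs
  imports "HOL-Analysis.Analysis"
begin

section \<open>Extended-real-valued convex analysis\<close>

definition effective_domain :: "('a \<Rightarrow> ereal) \<Rightarrow> 'a set" where
  "effective_domain h = {x. h x < \<infinity>}"

definition ereal_epigraph :: "('a \<Rightarrow> ereal) \<Rightarrow> ('a \<times> real) set" where
  "ereal_epigraph h = {(x, r). h x \<le> ereal r}"

definition closed_proper_convex :: "('a::euclidean_space \<Rightarrow> ereal) \<Rightarrow> bool" where
  "closed_proper_convex h \<longleftrightarrow>
     closed (ereal_epigraph h) \<and> convex (ereal_epigraph h) \<and>
     (\<forall>x. h x \<noteq> -\<infinity>) \<and> effective_domain h \<noteq> {}"

definition fenchel_conjugate :: "('a::euclidean_space \<Rightarrow> ereal) \<Rightarrow> 'a \<Rightarrow> ereal" where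
  "fenchel_conjugate h y = (SUP x. ereal (y \<bullet> x) - h x)"

text \<open>For proper \<open>h\<close> this set is automatically empty at points outside the effective domain.\<close>
definition subdifferential :: "('a::euclidean_space \<Rightarrow> ereal) \<Rightarrow> 'a \<Rightarrow> 'a set" where
  "subdifferential h x = {u. \<forall>y. h y \<ge> h x + ereal (u \<bullet> (y - x))}"

definition strongly_convex :: "real \<Rightarrow> ('a::euclidean_space \<Rightarrow> ereal) \<Rightarrow> bool" where
  "strongly_convex \<gamma> h \<longleftrightarrow>
     (\<forall>x y. \<forall>u \<in> subdifferential h x.
        h y \<ge> h x + ereal (u \<bullet> (y - x)) + ereal (\<gamma> / 2 * (norm (y - x))\<^sup>2))"

text \<open>The minimizer exists and is unique for closed proper convex \<open>h\<close> and \<open>lam > 0\<close>,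
  so the choice made by \<open>ARG_MIN\<close> is immaterial.\<close>
definition prox :: "real \<Rightarrow> ('a::euclidean_space \<Rightarrow> ereal) \<Rightarrow> 'a \<Rightarrow> 'a" where
  "prox lam h x = (ARG_MIN (\<lambda>y. h y + ereal (1 / (2 * lam) * (norm (y - x))\<^sup>2)) y. True)"

section \<open>The saddle point problem\<close>

definition primal_solutions ::
    "('q::euclidean_space \<Rightarrow> ereal) \<Rightarrow> ('p::euclidean_space \<Rightarrow> ereal) \<Rightarrow> ('q \<Rightarrow> 'p) \<Rightarrow> 'q set" where
  "primal_solutions g f K = {x. is_arg_min (\<lambda>x. g x + f (K x)) (\<lambda>_. True) x}"

definition lagrangian ::
    "('q::euclidean_space \<Rightarrow> ereal) \<Rightarrow> ('p::euclidean_space \<Rightarrow> ereal) \<Rightarrow> ('q \<Rightarrow> 'p)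
      \<Rightarrow> 'q \<Rightarrow> 'p \<Rightarrow> ereal" where
  "lagrangian g f K x y = g x + ereal (K x \<bullet> y) - fenchel_conjugate f y"

definition saddle_solutions ::
    "('q::euclidean_space \<Rightarrow> ereal) \<Rightarrow> ('p::euclidean_space \<Rightarrow> ereal) \<Rightarrow> ('q \<Rightarrow> 'p)
      \<Rightarrow> ('q \<times> 'p) set" where
  "saddle_solutions g f K =
     {(xb, yb). 0 \<in> (\<lambda>u. u + adjoint K yb) ` subdifferential g xb \<and>
                0 \<in> (\<lambda>v. v - K xb) ` subdifferential (fenchel_conjugate f) yb}"

text \<open>Only used for \<open>(xb, yb)\<close> in \<^const>\<open>saddle_solutions\<close>; there \<open>g xb\<close> and the conjugate
  at \<open>yb\<close> are finite, so no \<open>\<infinity> - \<infinity>\<close> can occur.\<close>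
definition pd_gap ::
    "('q::euclidean_space \<Rightarrow> ereal) \<Rightarrow> ('p::euclidean_space \<Rightarrow> ereal) \<Rightarrow> ('q \<Rightarrow> 'p)
      \<Rightarrow> 'q \<Rightarrow> 'p \<Rightarrow> 'q \<Rightarrow> 'p \<Rightarrow> ereal" where
  "pd_gap g f K xb yb x y = lagrangian g f K x yb - lagrangian g f K xb y"

section \<open>Accelerated GRPDA with linesearch\<close>

definition golden_ratio :: real where
  "golden_ratio = (sqrt 5 + 1) / 2"

definition psi0 :: real where
  "psi0 = (THE r. r ^ 3 - r - 1 = 0)"

definition varphi_of :: "real \<Rightarrow> real" where
  "varphi_of \<psi> = (1 + \<psi>) / \<psi>\<^sup>2"

definition omega_of :: "real \<Rightarrow> real \<Rightarrow> real \<Rightarrow> real" where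
  "omega_of \<gamma> \<psi> t = (\<psi> - varphi_of \<psi>) / (\<psi> + varphi_of \<psi> * \<gamma> * t)"

definition dual_step ::
    "('p::euclidean_space \<Rightarrow> ereal) \<Rightarrow> ('q::euclidean_space \<Rightarrow> 'p) \<Rightarrow> 'q \<Rightarrow> 'p
      \<Rightarrow> real \<Rightarrow> real \<Rightarrow> 'p" where
  "dual_step f K x yprev b t =
     prox (b * t) (fenchel_conjugate f) (yprev + (b * t) *\<^sub>R K x)"

text \<open>Acceptance test for the trial step size \<open>t\<close>; \<open>tprev\<close> is the previous step size and
  \<open>b\<close> the current \<open>\<beta>\<close>.\<close>
definition linesearch_ok ::
    "('p::euclidean_space \<Rightarrow> ereal) \<Rightarrow> ('q::euclidean_space \<Rightarrow> 'p) \<Rightarrow> real \<Rightarrow> 'q \<Rightarrow> 'p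
      \<Rightarrow> real \<Rightarrow> real \<Rightarrow> real \<Rightarrow> bool" where
  "linesearch_ok f K \<psi> x yprev b tprev t \<longleftrightarrow>
     (let ynew = dual_step f K x yprev b t in
      sqrt (b * t) * norm (adjoint K ynew - adjoint K yprev)
        \<le> sqrt (\<psi> / tprev) * norm (ynew - yprev))"

text \<open>An accepted exponent always exists, so \<open>LEAST\<close> is well defined.\<close>
definition agrpda_linesearch ::
    "('q::euclidean_space \<Rightarrow> ereal) \<Rightarrow> ('p::euclidean_space \<Rightarrow> ereal) \<Rightarrow> ('q \<Rightarrow> 'p)
      \<Rightarrow> real \<Rightarrow> real \<Rightarrow> real
      \<Rightarrow> (nat \<Rightarrow> 'q) \<Rightarrow> (nat \<Rightarrow> 'q) \<Rightarrow> (nat \<Rightarrow> 'p) \<Rightarrow> (nat \<Rightarrow> real) \<Rightarrow> (nat \<Rightarrow> real) \<Rightarrow> bool" where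
  "agrpda_linesearch g f K \<gamma> \<psi> \<mu> z x y \<beta> \<tau> \<longleftrightarrow>
     x 0 = z 0 \<and>
     (\<forall>n\<ge>1.
        z n = ((\<psi> - 1) / \<psi>) *\<^sub>R x (n - 1) + (1 / \<psi>) *\<^sub>R z (n - 1) \<and>
        x n = prox (\<tau> (n - 1)) g (z n - \<tau> (n - 1) *\<^sub>R adjoint K (y (n - 1))) \<and>
        \<beta> n = \<beta> (n - 1) * (1 + \<gamma> * omega_of \<gamma> \<psi> (\<tau> (n - 1)) * \<tau> (n - 1)) \<and>
        \<tau> n = varphi_of \<psi> * \<tau> (n - 1) *
          \<mu> ^ (LEAST i. linesearch_ok f K \<psi> (x n) (y (n - 1)) (\<beta> n) (\<tau> (n - 1))
                           (varphi_of \<psi> * \<tau> (n - 1) * \<mu> ^ i)) \<and>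
        y n = dual_step f K (x n) (y (n - 1)) (\<beta> n) (\<tau> n))"

end

theory Submission
  imports Defs
begin

text \<open>Adding the subgradient inequalities of the proximal steps at a saddle point \<open>(xs, ys)\<close>, the
  linesearch condition absorbs the cross term and the quantity
  \<open>\<beta> n (\<psi> + \<gamma> \<tau> n) / (\<psi> - 1) \<bar>z (n + 1) - xs\<bar>\<^sup>2 + \<bar>y (n - 1) - ys\<bar>\<^sup>2\<close> decreases by at least
  \<open>2 \<beta> n \<tau> n\<close> times the gap at \<open>(x n, y n)\<close>. Everything then rests on \<open>\<beta> n \<ge> c n\<^sup>2\<close>. The linesearch bounds
  only the product \<open>\<beta> n \<tau> n \<tau> (n - 1)\<close> from below after a backtracking, so \<open>\<tau> n\<close> may be much smaller than
  \<open>1 / sqrt (\<beta> n)\<close> if \<open>\<tau> (n - 1)\<close> was large; but a large step has made \<open>sqrt \<beta>\<close> grow by more than the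
  logarithmic recovery time, and a potential in \<open>sqrt \<beta>\<close> and \<open>ln (\<tau> sqrt \<beta>)\<close> increases by a constant at
  each step.\<close>

section \<open>Proximal points and subgradients\<close>

text \<open>The relative interior condition yields a multiplier, which shows at once that the
  conjugate of \<open>f\<close> is proper and that a saddle point exists. All estimates are then
  made relative to an arbitrary saddle point, so that they can be repeated for each one in the gap
  bound. The value \<phi> = \<open>varphi_of \<psi>\<close> solves \<psi> \<phi> = 1 + 1 / \<psi>.
  As steps grow at most by the factor \<phi>, this makes the coefficient of the uncontrolled term |x
  (n + 2) - z (n + 2)|^2 nonpositive. At \<open>psi0\<close> one has \<phi> = \<psi>, at the golden
  ratio \<phi> = 1; between them \<omega> is positive and step sizes can increase. A direct
  induction for the growth of \<beta> would need \<tau> n >= const / sqrt (\<beta> n) at every n. In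
  the variable s = \<tau> sqrt \<beta> the recursion has constants independent of n: either s grows
  at least by the factor \<phi>, or the product of two consecutive values is bounded below. The same
  dichotomy produces infinitely many pairs of consecutive values of s that are not small. The
  cluster point is taken along these, because a tiny \<tau> could amplify the residuals of the
  optimality conditions.\<close>

lemma closed_proper_convexD:
  assumes "closed_proper_convex h"
  shows "closed (ereal_epigraph h)" "convex (ereal_epigraph h)" "h x \<noteq> -\<infinity>"
    "\<exists>x r. h x = ereal r"
proof -
  show "closed (ereal_epigraph h)" "convex (ereal_epigraph h)" "h x \<noteq> -\<infinity>"
    using assms by (auto simp: closed_proper_convex_def)
  obtain x where "h x < \<infinity>" "h x \<noteq> -\<infinity>"
    using assms by (auto simp: closed_proper_convex_def effective_domain_def)
  then show "\<exists>x r. h x = ereal r"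
    by (cases "h x") auto
qed

lemma subdifferential_finite:
  assumes h: "closed_proper_convex h" and u: "u \<in> subdifferential h x"
  obtains r where "h x = ereal r"
proof -
  obtain y s where "h y = ereal s"
    using closed_proper_convexD(4)[OF h] by blast
  moreover have "h y \<ge> h x + ereal (u \<bullet> (y - x))"
    using u by (auto simp: subdifferential_def)
  ultimately have "h x \<noteq> \<infinity>" by auto
  then show thesis
    using that closed_proper_convexD(3)[OF h, of x] by (cases "h x") auto
qed

lemma subdifferential_realD:
  assumes "u \<in> subdifferential h x" "h x = ereal a" "h y = ereal b"
  shows "a + u \<bullet> (y - x) \<le> b"
proof -
  have "h y \<ge> h x + ereal (u \<bullet> (y - x))"
    using assms(1) by (auto simp: subdifferential_def)
  then show ?thesis using assms(2,3) by simp
qed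

lemma subdifferential_realI:
  assumes h: "closed_proper_convex h" and "h x = ereal a"
    and "\<And>y b. h y = ereal b \<Longrightarrow> a + u \<bullet> (y - x) \<le> b"
  shows "u \<in> subdifferential h x"
  unfolding subdifferential_def
proof safe
  fix y
  show "h x + ereal (u \<bullet> (y - x)) \<le> h y"
    using assms(2) assms(3)[of y] closed_proper_convexD(3)[OF h, of y] by (cases "h y") auto
qed

lemma strongly_convex_realD:
  assumes "strongly_convex \<gamma> h" "u \<in> subdifferential h x" "h x = ereal a" "h y = ereal b"
  shows "a + u \<bullet> (y - x) + \<gamma> / 2 * (norm (y - x))\<^sup>2 \<le> b"
proof -
  have "h y \<ge> h x + ereal (u \<bullet> (y - x)) + ereal (\<gamma> / 2 * (norm (y - x))\<^sup>2)"
    using assms(1,2) by (auto simp: strongly_convex_def)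
  then show ?thesis using assms(3,4) by simp
qed

lemma epigraph_convexD:
  assumes h: "closed_proper_convex h" and "h x = ereal a" "h y = ereal b" "0 \<le> t" "t \<le> 1"
  obtains c where "h (x + t *\<^sub>R (y - x)) = ereal c" "c \<le> a + t * (b - a)"
proof -
  have "(1 - t) *\<^sub>R (x, a) + t *\<^sub>R (y, b) \<in> ereal_epigraph h"
    using closed_proper_convexD(2)[OF h] assms
    by (intro convexD) (auto simp: ereal_epigraph_def)
  moreover have "(1 - t) *\<^sub>R (x, a) + t *\<^sub>R (y, b) = (x + t *\<^sub>R (y - x), a + t * (b - a))"
    by (auto simp: algebra_simps)
  ultimately have le: "h (x + t *\<^sub>R (y - x)) \<le> ereal (a + t * (b - a))"
    by (auto simp: ereal_epigraph_def)
  then show thesis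
    using that closed_proper_convexD(3)[OF h, of "x + t *\<^sub>R (y - x)"]
    by (cases "h (x + t *\<^sub>R (y - x))") auto
qed

lemma epigraph_Jensen:
  fixes w v :: "nat \<Rightarrow> real"
  assumes h: "closed_proper_convex h" and "finite I" and "\<And>i. i \<in> I \<Longrightarrow> 0 \<le> w i"
    and "sum w I = 1" and "\<And>i. i \<in> I \<Longrightarrow> h (p i) = ereal (v i)"
  obtains c where "h (\<Sum>i\<in>I. w i *\<^sub>R p i) = ereal c" "c \<le> (\<Sum>i\<in>I. w i * v i)"
proof -
  have "(\<Sum>i\<in>I. w i *\<^sub>R (p i, v i)) \<in> ereal_epigraph h"
    using closed_proper_convexD(2)[OF h] assms
    by (intro convex_sum) (auto simp: ereal_epigraph_def)
  moreover have "(\<Sum>i\<in>I. w i *\<^sub>R (p i, v i)) = (\<Sum>i\<in>I. w i *\<^sub>R p i, \<Sum>i\<in>I. w i * v i)"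
    by (simp add: prod_eq_iff fst_sum snd_sum)
  ultimately have "h (\<Sum>i\<in>I. w i *\<^sub>R p i) \<le> ereal (\<Sum>i\<in>I. w i * v i)"
    by (auto simp: ereal_epigraph_def)
  then show thesis
    using that closed_proper_convexD(3)[OF h, of "\<Sum>i\<in>I. w i *\<^sub>R p i"]
    by (cases "h (\<Sum>i\<in>I. w i *\<^sub>R p i)") auto
qed

text \<open>Read as membership of \<open>(p k, b - u k \<bullet> (y - p k))\<close> in the epigraph,
  the subgradient inequality passes to the limit by closedness. The values \<open>h (p k)\<close>,
  which might fail to converge, do not enter.\<close>

lemma subdifferential_closed_graph:
  assumes h: "closed_proper_convex h" and sub: "\<And>k. u k \<in> subdifferential h (p k)"
    and p: "p \<longlonglongrightarrow> q" and u: "u \<longlonglongrightarrow> v"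
  shows "v \<in> subdifferential h q"
proof -
  have lim: "h q \<le> ereal (b - v \<bullet> (y - q))" if y: "h y = ereal b" for y b
  proof -
    have epi: "(p k, b - u k \<bullet> (y - p k)) \<in> ereal_epigraph h" for k
    proof -
      obtain a where a: "h (p k) = ereal a"
        using subdifferential_finite[OF h sub] .
      show ?thesis
        using subdifferential_realD[OF sub a y] a by (simp add: ereal_epigraph_def)
    qed
    have "(\<lambda>k. (p k, b - u k \<bullet> (y - p k))) \<longlonglongrightarrow> (q, b - v \<bullet> (y - q))"
      by (rule tendsto_Pair[OF p]) (intro tendsto_intros p u)
    with epi have "(q, b - v \<bullet> (y - q)) \<in> ereal_epigraph h"
      by (rule closed_sequentially[OF closed_proper_convexD(1)[OF h]])
    then show ?thesis by (simp add: ereal_epigraph_def)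
  qed
  obtain y b where "h y = ereal b"
    using closed_proper_convexD(4)[OF h] by blast
  from lim[OF this] obtain a where a: "h q = ereal a"
    using closed_proper_convexD(3)[OF h, of q] by (cases "h q") auto
  show ?thesis
    using lim a by (intro subdifferential_realI[OF h a]) (force simp: algebra_simps)
qed

text \<open>\<open>ARG_MIN\<close> is a bare choice, so nothing is known of \<open>prox\<close>
  before a minimizer is shown to exist. The affine minorant makes the objective coercive.\<close>

lemma prox_minimizes:
  fixes h :: "'a::euclidean_space \<Rightarrow> ereal"
  assumes h: "closed_proper_convex h" and lam: "lam > 0"
    and minorant: "\<And>y b. h y = ereal b \<Longrightarrow> c + a \<bullet> y \<le> b"
  shows "h (prox lam h x) + ereal (1 / (2 * lam) * (norm (prox lam h x - x))\<^sup>2)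
    \<le> h y + ereal (1 / (2 * lam) * (norm (y - x))\<^sup>2)"
proof -
  define \<Phi> where "\<Phi> = (\<lambda>(y, r). r + 1 / (2 * lam) * (norm (y - x))\<^sup>2)"
  define F where "F = (\<lambda>y. h y + ereal (1 / (2 * lam) * (norm (y - x))\<^sup>2))"
  obtain y0 b0 where y0: "h y0 = ereal b0"
    using closed_proper_convexD(4)[OF h] by blast
  \<comment> \<open>In \<open>y\<close> alone the objective is only lower semicontinuous; lifted to
    the epigraph it is the continuous function \<Phi>, and the extreme value theorem applies to the
    compact slice \<open>S\<close>.\<close>
  define S where "S = ereal_epigraph h \<inter> {p. \<Phi> p \<le> \<Phi> (y0, b0)}"
  have cont: "continuous_on UNIV \<Phi>"
    unfolding \<Phi>_def case_prod_beta by (intro continuous_intros)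
  have "closed S"
    unfolding S_def using closed_proper_convexD(1)[OF h] cont
    by (intro closed_Int closed_Collect_le) (auto intro: continuous_intros)
  moreover have "bounded S"
  proof -
    \<comment> \<open>Completing the square in |y - x|^2 + 2 lam (a, y) gives a ball around
      \<open>x - lam *\<^sub>R a\<close> whose squared radius is \<open>R\<close>.\<close>
    define R where "R = 2 * lam * (\<Phi> (y0, b0) - c - a \<bullet> x) + lam\<^sup>2 * (a \<bullet> a)"
    define M where "M = norm (x - lam *\<^sub>R a) + sqrt R"
    have "S \<subseteq> cball 0 M \<times> {c - norm a * M .. \<Phi> (y0, b0)}"
    proof
      fix p assume p: "p \<in> S"
      obtain y r where yr: "p = (y, r)" by (cases p)
      have hr: "h y \<le> ereal r" and le: "r + 1 / (2 * lam) * (norm (y - x))\<^sup>2 \<le> \<Phi> (y0, b0)"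
        using p yr by (auto simp: S_def ereal_epigraph_def \<Phi>_def)
      obtain b where b: "h y = ereal b"
        using hr closed_proper_convexD(3)[OF h, of y] by (cases "h y") auto
      have r: "c + a \<bullet> y \<le> r" using minorant[OF b] hr b by simp
      have "(norm (y - x))\<^sup>2 \<le> 2 * lam * (\<Phi> (y0, b0) - r)"
        using le lam by (simp add: field_simps)
      also have "\<dots> \<le> 2 * lam * (\<Phi> (y0, b0) - (c + a \<bullet> y))"
        using r lam by simp
      finally have "(norm (y - (x - lam *\<^sub>R a)))\<^sup>2 \<le> R"
        unfolding R_def power2_norm_eq_inner unfolding power2_eq_square
        by (simp add: inner_commute algebra_simps)
      then have "norm (y - (x - lam *\<^sub>R a)) \<le> sqrt R"
        using real_le_rsqrt by blast
      then have nM: "norm y \<le> M"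
        unfolding M_def using norm_triangle_ineq2[of y "x - lam *\<^sub>R a"] by linarith
      have "- (a \<bullet> y) \<le> norm a * norm y"
        using norm_cauchy_schwarz[of "- a" y] by simp
      also have "\<dots> \<le> norm a * M" using nM by (simp add: mult_left_mono)
      finally have "c - norm a * M \<le> r" using r by linarith
      moreover have "0 \<le> 1 / (2 * lam) * (norm (y - x))\<^sup>2" using lam by simp
      then have "r \<le> \<Phi> (y0, b0)" using le by linarith
      ultimately show "p \<in> cball 0 M \<times> {c - norm a * M .. \<Phi> (y0, b0)}"
        using nM yr by simp
    qed
    then show ?thesis
      by (rule bounded_subset[rotated]) (intro bounded_Times bounded_cball bounded_closed_interval)
  qed
  ultimately have "compact S" by (simp add: compact_eq_bounded_closed)
  moreover have "(y0, b0) \<in> S" using y0 by (simp add: S_def ereal_epigraph_def)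
  ultimately obtain p where p: "p \<in> S" "\<And>q. q \<in> S \<Longrightarrow> \<Phi> p \<le> \<Phi> q"
    using continuous_attains_inf[of S \<Phi>] continuous_on_subset[OF cont] by blast
  have Fp: "F (fst p) \<le> F y" for y
  proof (cases "h y")
    case (real b)
    have "F (fst p) \<le> ereal (\<Phi> p)"
    proof -
      have "h (fst p) \<le> ereal (snd p)" using p(1) by (auto simp: S_def ereal_epigraph_def)
      then have "F (fst p) \<le> ereal (snd p) + ereal (1 / (2 * lam) * (norm (fst p - x))\<^sup>2)"
        unfolding F_def by (rule add_right_mono)
      then show ?thesis by (simp add: \<Phi>_def case_prod_beta)
    qed
    also have "\<Phi> p \<le> \<Phi> (y, b)"
    proof (cases "\<Phi> (y, b) \<le> \<Phi> (y0, b0)")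
      case True
      then show ?thesis using real p(2) by (auto simp: S_def ereal_epigraph_def)
    next
      case False
      then show ?thesis using p(1) by (auto simp: S_def)
    qed
    finally show ?thesis using real by (simp add: F_def \<Phi>_def)
  qed (use closed_proper_convexD(3)[OF h, of y] in \<open>auto simp: F_def\<close>)
  have "is_arg_min F (\<lambda>_. True) (fst p)"
    using Fp by (auto simp: is_arg_min_def not_less)
  then have "is_arg_min F (\<lambda>_. True) (prox lam h x)"
    unfolding prox_def arg_min_def F_def by (rule someI)
  then show ?thesis by (auto simp: is_arg_min_def F_def not_less)
qed

text \<open>First-order optimality: the minimizer \<open>p\<close> is compared with
  \<open>p + t *\<^sub>R (y - p)\<close>. Convexity makes the change of \<open>h\<close> at most
  linear in \<open>t\<close>, the quadratic term adds a linear part and one of order t^2; dividing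
  by \<open>t\<close> and letting it tend to 0 gives the subgradient inequality.\<close>

lemma prox_subgradient:
  fixes h :: "'a::euclidean_space \<Rightarrow> ereal"
  assumes h: "closed_proper_convex h" and lam: "lam > 0"
    and minorant: "\<And>y b. h y = ereal b \<Longrightarrow> c + a \<bullet> y \<le> b"
  shows "(1 / lam) *\<^sub>R (x - prox lam h x) \<in> subdifferential h (prox lam h x)"
proof -
  define p where "p = prox lam h x"
  have min: "h p + ereal (1 / (2 * lam) * (norm (p - x))\<^sup>2)
    \<le> h y + ereal (1 / (2 * lam) * (norm (y - x))\<^sup>2)" for y
    unfolding p_def by (rule prox_minimizes[OF assms])
  obtain y0 b0 where "h y0 = ereal b0"
    using closed_proper_convexD(4)[OF h] by blast
  then obtain r where r: "h p = ereal r"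
    using min[of y0] closed_proper_convexD(3)[OF h, of p] by (cases "h p") auto
  have "(1 / lam) *\<^sub>R (x - p) \<in> subdifferential h p"
  proof (rule subdifferential_realI[OF h r])
    fix y b assume b: "h y = ereal b"
    define d where "d = b - r - (1 / lam) * ((x - p) \<bullet> (y - p))"
    define e where "e = 1 / (2 * lam) * (norm (y - p))\<^sup>2"
    have *: "0 \<le> d + t * e" if t: "0 < t" "t \<le> 1" for t
    proof -
      obtain s where s: "h (p + t *\<^sub>R (y - p)) = ereal s" "s \<le> r + t * (b - r)"
        using epigraph_convexD[OF h r b, of t] t by auto
      have "r + 1 / (2 * lam) * (norm (p - x))\<^sup>2
          \<le> s + 1 / (2 * lam) * (norm (p + t *\<^sub>R (y - p) - x))\<^sup>2"
        using min[of "p + t *\<^sub>R (y - p)"] r s by simp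
      moreover have "(norm (p + t *\<^sub>R (y - p) - x))\<^sup>2
          = (norm (p - x))\<^sup>2 - 2 * t * ((x - p) \<bullet> (y - p)) + t\<^sup>2 * (norm (y - p))\<^sup>2"
        unfolding power2_norm_eq_inner unfolding power2_eq_square
        by (simp add: inner_commute algebra_simps)
      ultimately have "r + 1 / (2 * lam) * (norm (p - x))\<^sup>2 \<le> r + t * (b - r)
          + 1 / (2 * lam) * ((norm (p - x))\<^sup>2 - 2 * t * ((x - p) \<bullet> (y - p)) + t\<^sup>2 * (norm (y - p))\<^sup>2)"
        using s(2) by simp
      then have "0 \<le> t * (b - r) + 1 / (2 * lam) * (- 2 * t * ((x - p) \<bullet> (y - p)) + t\<^sup>2 * (norm (y - p))\<^sup>2)"
        by (simp add: algebra_simps)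
      also have "\<dots> = t * (d + t * e)"
        unfolding d_def e_def by (simp add: algebra_simps power2_eq_square)
      finally have "0 \<le> t * (d + t * e)" .
      then show ?thesis using t by (simp add: zero_le_mult_iff)
    qed
    have "((\<lambda>t. d + t * e) \<longlongrightarrow> d + 0 * e) (at_right 0)"
      by (intro tendsto_intros)
    moreover have "eventually (\<lambda>t. 0 \<le> d + t * e) (at_right (0::real))"
      using * by (auto simp: eventually_at_right_field intro!: exI[of _ 1])
    ultimately have "0 \<le> d + 0 * e"
      by (intro tendsto_lowerbound) auto
    then show "r + (1 / lam) *\<^sub>R (x - p) \<bullet> (y - p) \<le> b" by (simp add: d_def)
  qed
  then show ?thesis by (simp add: p_def)
qed

section \<open>Conjugates\<close>

lemma fenchel_conjugate_le_iff:
  assumes "\<And>x. f x \<noteq> -\<infinity>"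
  shows "fenchel_conjugate f y \<le> ereal r \<longleftrightarrow> (\<forall>x a. f x = ereal a \<longrightarrow> y \<bullet> x - a \<le> r)"
proof -
  have "ereal (y \<bullet> x) - f x \<le> ereal r \<longleftrightarrow> (\<forall>a. f x = ereal a \<longrightarrow> y \<bullet> x - a \<le> r)" for x
    using assms[of x] by (cases "f x") auto
  then show ?thesis by (auto simp: fenchel_conjugate_def SUP_le_iff)
qed

text \<open>The epigraph of a supremum of affine functions is an intersection of closed half-spaces,
  one for each finite value of \<open>f\<close>. The finite value at \<open>y0\<close> provides a
  point of the domain; it will come from a subgradient of \<open>f\<close>.\<close>

lemma fenchel_conjugate_closed_proper_convex:
  assumes f: "closed_proper_convex f" and y0: "fenchel_conjugate f y0 = ereal r0"
  shows "closed_proper_convex (fenchel_conjugate f)"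
proof -
  have le: "fenchel_conjugate f y \<le> ereal r \<longleftrightarrow> (\<forall>x a. f x = ereal a \<longrightarrow> y \<bullet> x - a \<le> r)" for y r
    using fenchel_conjugate_le_iff closed_proper_convexD(3)[OF f] by blast
  have eq: "ereal_epigraph (fenchel_conjugate f)
      = (\<Inter>(x, a)\<in>{(x, a). f x = ereal a}. {p. (x, -1) \<bullet> p \<le> a})"
    by (auto simp: ereal_epigraph_def le inner_commute algebra_simps)
  have "fenchel_conjugate f y \<noteq> -\<infinity>" for y
  proof
    assume "fenchel_conjugate f y = -\<infinity>"
    moreover obtain x a where "f x = ereal a"
      using closed_proper_convexD(4)[OF f] by blast
    ultimately show False
      using le[of y "y \<bullet> x - a - 1"] by (metis diff_add_cancel ereal_infty_less_eq2(2) less_add_one linorder_not_less ereal_less_eq(2))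
  qed
  moreover have "closed (ereal_epigraph (fenchel_conjugate f))"
    unfolding eq by (intro closed_INT) (auto simp: closed_halfspace_le)
  moreover have "convex (ereal_epigraph (fenchel_conjugate f))"
    unfolding eq by (intro convex_INT) (auto simp: convex_halfspace_le)
  ultimately show ?thesis
    using y0 by (auto simp: closed_proper_convex_def effective_domain_def intro!: exI[of _ y0])
qed

section \<open>Fenchel-Rockafellar duality\<close>

lemma saddle_solutions_iff:
  "(xb, yb) \<in> saddle_solutions g f K \<longleftrightarrow>
    - adjoint K yb \<in> subdifferential g xb \<and> K xb \<in> subdifferential (fenchel_conjugate f) yb"
proof -
  have "0 = u + adjoint K yb \<longleftrightarrow> u = - adjoint K yb" for u
    by (metis add.inverse_inverse add_eq_0_iff2)
  then show ?thesis
    by (auto simp: saddle_solutions_def image_iff)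
qed

lemma convex_effective_domain:
  assumes h: "closed_proper_convex h"
  shows "convex (effective_domain h)"
proof -
  have "effective_domain h = fst ` ereal_epigraph h"
  proof (intro equalityI subsetI)
    fix x assume "x \<in> effective_domain h"
    then obtain a where "h x = ereal a"
      using closed_proper_convexD(3)[OF h, of x] by (cases "h x") (auto simp: effective_domain_def)
    then have "(x, a) \<in> ereal_epigraph h" by (simp add: ereal_epigraph_def)
    then show "x \<in> fst ` ereal_epigraph h" by force
  qed (auto simp: ereal_epigraph_def effective_domain_def intro: le_less_trans)
  then show ?thesis
    using convex_linear_image[OF linear_fst closed_proper_convexD(2)[OF h]] by simp
qed

text \<open>The multiplier is the slope of a hyperplane supporting the epigraph of the perturbed
  value function \<open>v \<mapsto> inf\<^sub>x g x + f (K x + v)\<close> at \<open>v = 0\<close>; the relative interior condition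
  makes this hyperplane non-vertical.\<close>
lemma Fenchel_Rockafellar_multiplier:
  fixes g :: "'q::euclidean_space \<Rightarrow> ereal" and f :: "'p::euclidean_space \<Rightarrow> ereal"
  assumes f: "closed_proper_convex f" and g: "closed_proper_convex g" and K: "linear K"
    and ri: "xt \<in> rel_interior (effective_domain g)" "K xt \<in> rel_interior (effective_domain f)"
    and xs: "xs \<in> primal_solutions g f K"
  obtains yb where "yb \<in> subdifferential f (K xs)" "- adjoint K yb \<in> subdifferential g xs"
proof -
  have min: "g xs + f (K xs) \<le> g x + f (K x)" for x
    using xs by (auto simp: primal_solutions_def is_arg_min_def not_less)
  have "g xt < \<infinity>" "f (K xt) < \<infinity>"
    using ri rel_interior_subset by (auto simp: effective_domain_def)
  then have "g xs + f (K xs) < \<infinity>"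
    using min[of xt] by (auto intro: le_less_trans)
  then obtain a b where ab: "g xs = ereal a" "f (K xs) = ereal b"
    using closed_proper_convexD(3)[OF f, of "K xs"] closed_proper_convexD(3)[OF g, of xs]
    by (cases "g xs"; cases "f (K xs)") auto
  \<comment> \<open>The image \<open>C\<close> consists of the points
    \<open>(w - K x, s + t)\<close> above the perturbed value function, so its lowest point over 0
    has height \<open>a + b\<close>, the optimal value.\<close>
  define T :: "('q \<times> real) \<times> ('p \<times> real) \<Rightarrow> 'p \<times> real"
    where "T = (\<lambda>p. (fst (snd p) - K (fst (fst p)), snd (fst p) + snd (snd p)))"
  define C where "C = T ` (ereal_epigraph g \<times> ereal_epigraph f)"
  have linT: "linear T"
    by (intro linearI) (auto simp: T_def linear_add[OF K] linear_scale[OF K] algebra_simps)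
  have convC: "convex C"
    unfolding C_def using closed_proper_convexD(2)[OF f] closed_proper_convexD(2)[OF g]
    by (intro convex_linear_image linT convex_Times)
  have inC: "(w - K x, s + t) \<in> C" if "g x \<le> ereal s" "f w \<le> ereal t" for x w s t
    unfolding C_def T_def using that
    by (intro image_eqI[of _ _ "((x, s), (w, t))"]) (auto simp: ereal_epigraph_def)
  have C0: "(0, a + b) \<in> C" "(0, a + b + 1) \<in> C"
    using inC[of xs a "K xs" b] inC[of xs a "K xs" "b + 1"] ab by (auto simp: add.assoc)
  have C_ge: "a + b \<le> r" if r: "(0, r) \<in> C" for r
  proof -
    obtain x s t where "g x \<le> ereal s" "f (K x) \<le> ereal t" "r = s + t"
      using r by (auto simp: C_def T_def ereal_epigraph_def)
    then have "g x + f (K x) \<le> ereal r"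
      using add_mono[of "g x" "ereal s" "f (K x)" "ereal t"] by simp
    from order_trans[OF min[of x] this] show ?thesis by (simp add: ab)
  qed
  \<comment> \<open>From a relative interior point, the segment coming down from
    \<open>(0, a + b + 1)\<close> could be prolonged below the optimal value.\<close>
  have "(0, a + b) \<notin> rel_interior C"
  proof
    assume "(0, a + b) \<in> rel_interior C"
    then obtain e where "e > 1" "(1 - e) *\<^sub>R (0, a + b + 1) + e *\<^sub>R (0, a + b) \<in> C"
      using convex_rel_interior_iff[OF convC] C0 by blast
    moreover have "(1 - e) *\<^sub>R (0::'p, a + b + 1) + e *\<^sub>R (0, a + b) = (0, a + b + (1 - e))"
      by (simp add: algebra_simps)
    ultimately show False using C_ge[of "a + b + (1 - e)"] by auto
  qed
  from supporting_hyperplane_rel_boundary[OF convC C0(1) this]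
  obtain c where c: "\<And>p. p \<in> C \<Longrightarrow> c \<bullet> (0, a + b) \<le> c \<bullet> p"
      "\<And>p. p \<in> rel_interior C \<Longrightarrow> c \<bullet> (0, a + b) < c \<bullet> p"
    by metis
  \<comment> \<open>The projection of \<open>C\<close> is the image of the two domains under
    \<open>L\<close>. Relative interiors commute with linear images of convex sets, so the
    qualification at \<open>xt\<close> puts a point over 0 into the relative interior of
    \<open>C\<close>.\<close>
  define L :: "'q \<times> 'p \<Rightarrow> 'p" where "L = (\<lambda>p. snd p - K (fst p))"
  have linL: "linear L"
    by (intro linearI) (auto simp: L_def linear_add[OF K] linear_scale[OF K] algebra_simps)
  have "fst ` C = L ` (effective_domain g \<times> effective_domain f)"
  proof (intro equalityI subsetI)
    fix v assume "v \<in> fst ` C"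
    then obtain x w s t where "g x \<le> ereal s" "f w \<le> ereal t" "v = w - K x"
      by (auto simp: C_def T_def ereal_epigraph_def)
    then show "v \<in> L ` (effective_domain g \<times> effective_domain f)"
      by (intro image_eqI[of _ _ "(x, w)"]) (auto simp: L_def effective_domain_def intro: le_less_trans)
  next
    fix v assume "v \<in> L ` (effective_domain g \<times> effective_domain f)"
    then obtain x w where xw: "g x < \<infinity>" "f w < \<infinity>" "v = w - K x"
      by (auto simp: L_def effective_domain_def)
    then obtain s t where "g x = ereal s" "f w = ereal t"
      using closed_proper_convexD(3)[OF f, of w] closed_proper_convexD(3)[OF g, of x]
      by (cases "g x"; cases "f w") auto
    then show "v \<in> fst ` C" using inC[of x s w t] xw by force
  qed
  then have "fst ` rel_interior C = L ` (rel_interior (effective_domain g) \<times> rel_interior (effective_domain f))"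
    using rel_interior_convex_linear_image[OF linear_fst convC]
      rel_interior_convex_linear_image[OF linL convex_Times]
      convex_effective_domain[OF f] convex_effective_domain[OF g]
    by (simp add: rel_interior_Times)
  moreover have "0 = L (xt, K xt)" by (simp add: L_def)
  ultimately have "0 \<in> fst ` rel_interior C" using ri by blast
  then obtain r where "(0, r) \<in> rel_interior C" by force
  \<comment> \<open>Were the hyperplane vertical, both sides of the strict inequality at
    \<open>(0, r)\<close> would be 0.\<close>
  from c(2)[OF this] have "snd c \<noteq> 0" by (cases c) auto
  moreover have "snd c \<ge> 0" using c(1)[OF C0(2)] by (cases c) (auto simp: algebra_simps)
  ultimately have pos: "snd c > 0" by simp
  define yb where "yb = - (1 / snd c) *\<^sub>R fst c"
  have key: "a + b + yb \<bullet> (w - K x) \<le> s + t" if "g x = ereal s" "f w = ereal t" for x w s t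
  proof -
    have "(w - K x, s + t) \<in> C" using inC that by simp
    from c(1)[OF this] have "snd c * (a + b) \<le> fst c \<bullet> (w - K x) + snd c * (s + t)"
      by (cases c) auto
    then have "(snd c * (a + b)) / snd c \<le> (fst c \<bullet> (w - K x) + snd c * (s + t)) / snd c"
      using pos by (intro divide_right_mono) auto
    also have "\<dots> = (fst c \<bullet> (w - K x)) / snd c + (s + t)"
      using pos by (simp add: add_divide_distrib)
    finally show ?thesis using pos by (simp add: yb_def)
  qed
  have "yb \<in> subdifferential f (K xs)"
  proof (rule subdifferential_realI[OF f ab(2)])
    fix w t assume "f w = ereal t"
    from key[OF ab(1) this] show "b + yb \<bullet> (w - K xs) \<le> t" by simp
  qed
  moreover have "- adjoint K yb \<in> subdifferential g xs"
  proof (rule subdifferential_realI[OF g ab(1)])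
    fix x s assume "g x = ereal s"
    from key[OF this ab(2)] show "a + - adjoint K yb \<bullet> (x - xs) \<le> s"
      by (simp add: inner_commute[of "adjoint K yb"] adjoint_works[OF K] linear_diff[OF K]
          inner_diff_left inner_diff_right inner_commute)
  qed
  ultimately show thesis using that by blast
qed

text \<open>By the Fenchel-Young equality the supremum defining the conjugate at \<open>y\<close> is
  attained at \<open>w\<close>. Its finite value there gives properness, and the term of
  \<open>w\<close> is an affine minorant of the conjugate that is exact at \<open>y\<close>.\<close>

lemma conjugate_subgradient:
  assumes f: "closed_proper_convex f" and y: "y \<in> subdifferential f w"
  shows "closed_proper_convex (fenchel_conjugate f)" "w \<in> subdifferential (fenchel_conjugate f) y"
proof -
  note le = fenchel_conjugate_le_iff[OF closed_proper_convexD(3)[OF f]]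
  obtain b where b: "f w = ereal b"
    using subdifferential_finite[OF f y] .
  have ge: "ereal (v \<bullet> w - b) \<le> fenchel_conjugate f v" for v
    unfolding fenchel_conjugate_def by (rule SUP_upper2[of w]) (simp_all add: b)
  have "fenchel_conjugate f y \<le> ereal (y \<bullet> w - b)"
    using subdifferential_realD[OF y b] by (simp add: le inner_diff_right) (smt (verit))
  then have eq: "fenchel_conjugate f y = ereal (y \<bullet> w - b)"
    using ge by (intro antisym)
  show f': "closed_proper_convex (fenchel_conjugate f)"
    by (rule fenchel_conjugate_closed_proper_convex[OF f eq])
  show "w \<in> subdifferential (fenchel_conjugate f) y"
  proof (rule subdifferential_realI[OF f' eq])
    fix v c assume "fenchel_conjugate f v = ereal c"
    then show "y \<bullet> w - b + w \<bullet> (v - y) \<le> c"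
      using ge[of v] by (simp add: inner_diff_right inner_commute)
  qed
qed

text \<open>\<open>strongly_convex\<close> says something only where a subgradient exists; the
  multiplier supplies one at \<open>xs\<close>. Adding the inequalities for \<open>g\<close> and
  \<open>f\<close> cancels the multiplier and leaves the quadratic term.\<close>

lemma primal_solution_unique:
  assumes f: "closed_proper_convex f" and g: "closed_proper_convex g" and K: "linear K"
    and \<gamma>: "\<gamma> > 0" "strongly_convex \<gamma> g"
    and xs: "xs \<in> primal_solutions g f K"
    and yb: "yb \<in> subdifferential f (K xs)" "- adjoint K yb \<in> subdifferential g xs"
  shows "primal_solutions g f K = {xs}"
proof -
  obtain a where a: "g xs = ereal a" using subdifferential_finite[OF g yb(2)] .
  obtain b where b: "f (K xs) = ereal b" using subdifferential_finite[OF f yb(1)] .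
  have "x = xs" if "x \<in> primal_solutions g f K" for x
  proof -
    have "g x + f (K x) \<le> g xs + f (K xs)"
      using that unfolding primal_solutions_def is_arg_min_def by (simp add: not_less)
    then have "g x + f (K x) \<le> ereal (a + b)" by (simp add: a b)
    then obtain s t where st: "g x = ereal s" "f (K x) = ereal t" "s + t \<le> a + b"
      using closed_proper_convexD(3)[OF f, of "K x"] closed_proper_convexD(3)[OF g, of x]
      by (cases "g x"; cases "f (K x)") auto
    have "a + - adjoint K yb \<bullet> (x - xs) + \<gamma> / 2 * (norm (x - xs))\<^sup>2 \<le> s"
      by (rule strongly_convex_realD[OF \<gamma>(2) yb(2) a st(1)])
    moreover have "b + yb \<bullet> (K x - K xs) \<le> t"
      by (rule subdifferential_realD[OF yb(1) b st(2)])
    moreover have "adjoint K yb \<bullet> (x - xs) = yb \<bullet> (K x - K xs)"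
      by (simp add: inner_commute[of "adjoint K yb"] inner_commute[of yb] adjoint_works[OF K] linear_diff[OF K])
    ultimately have "\<gamma> / 2 * (norm (x - xs))\<^sup>2 \<le> 0" using st(3) by simp
    then show ?thesis using \<gamma>(1) by (simp add: mult_le_0_iff)
  qed
  then show ?thesis using xs by blast
qed

text \<open>Monotonicity: of the four subgradient inequalities between the two saddle points, one is
  taken in its strong form; in the sum all values and bilinear terms cancel.\<close>

lemma saddle_solution_primal_unique:
  assumes f: "closed_proper_convex (fenchel_conjugate f)" and g: "closed_proper_convex g"
    and K: "linear K" and \<gamma>: "\<gamma> > 0" "strongly_convex \<gamma> g"
    and 1: "(x1, y1) \<in> saddle_solutions g f K" and 2: "(x2, y2) \<in> saddle_solutions g f K"
  shows "x1 = x2"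
proof -
  note sub = 1[unfolded saddle_solutions_iff] 2[unfolded saddle_solutions_iff]
  obtain a1 where a1: "g x1 = ereal a1" using sub subdifferential_finite[OF g] by blast
  obtain a2 where a2: "g x2 = ereal a2" using sub subdifferential_finite[OF g] by blast
  obtain b1 where b1: "fenchel_conjugate f y1 = ereal b1" using sub subdifferential_finite[OF f] by blast
  obtain b2 where b2: "fenchel_conjugate f y2 = ereal b2" using sub subdifferential_finite[OF f] by blast
  have "a1 + - adjoint K y1 \<bullet> (x2 - x1) + \<gamma> / 2 * (norm (x2 - x1))\<^sup>2 \<le> a2"
    using strongly_convex_realD[OF \<gamma>(2) _ a1 a2] sub by blast
  moreover have "a2 + - adjoint K y2 \<bullet> (x1 - x2) \<le> a1"
    using subdifferential_realD[OF _ a2 a1] sub by blast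
  moreover have "b1 + K x1 \<bullet> (y2 - y1) \<le> b2"
    using subdifferential_realD[OF _ b1 b2] sub by blast
  moreover have "b2 + K x2 \<bullet> (y1 - y2) \<le> b1"
    using subdifferential_realD[OF _ b2 b1] sub by blast
  moreover have "adjoint K y \<bullet> x = K x \<bullet> y" for x y
    by (simp add: inner_commute[of "adjoint K y"] adjoint_works[OF K])
  ultimately have "\<gamma> / 2 * (norm (x2 - x1))\<^sup>2 \<le> 0"
    by (simp add: inner_diff_right)
  then show ?thesis using \<gamma>(1) by (simp add: mult_le_0_iff)
qed

section \<open>Growth of the step sizes\<close>

text \<open>Since \<open>a\<close> stays above \<open>b\<close>, the additive loss \<open>B\<close>
  is at most \<open>B / b\<close> times \<open>a\<close> and turns into a constant factor. This
  gives bounds valid for all indices, not just large ones.\<close>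

lemma linear_lower_bound:
  fixes a b p :: real
  assumes "0 < b" "b \<le> a" "0 \<le> B" "p \<le> a + B"
  shows "p / (1 + B / b) \<le> a"
proof -
  have "B \<le> a * (B / b)"
  proof -
    have "b * (B / b) \<le> a * (B / b)" using assms by (intro mult_right_mono) auto
    then show ?thesis using assms(1) by simp
  qed
  then have "p \<le> a * (1 + B / b)" using assms(4) by (simp add: algebra_simps)
  moreover have "0 < 1 + B / b" using assms by (simp add: add_pos_nonneg)
  ultimately show ?thesis by (simp add: divide_le_eq)
qed

text \<open>Only the scalar recursion is kept. In \<open>\<tau>_Suc\<close> the first alternative is
  acceptance of the first trial step; the second records that some trial step was rejected, which is
  possible only if it was large relative to \<open>\<beta> (Suc n)\<close> and
  \<open>\<tau> n\<close>.\<close>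

locale step_sizes =
  fixes \<gamma> \<psi> \<phi> c :: real and \<beta> \<tau> :: "nat \<Rightarrow> real"
  assumes \<gamma>: "0 < \<gamma>" and \<phi>: "1 < \<phi>" "\<phi> < \<psi>" and c: "0 < c"
    and \<beta>_0: "0 < \<beta> 0" and \<tau>_pos: "0 < \<tau> n"
    and \<beta>_Suc: "\<beta> (Suc n) = \<beta> n * (1 + \<gamma> * ((\<psi> - \<phi>) / (\<psi> + \<phi> * \<gamma> * \<tau> n)) * \<tau> n)"
    and \<tau>_Suc: "\<tau> (Suc n) = \<phi> * \<tau> n \<or>
      (\<tau> (Suc n) \<le> \<phi> * \<tau> n \<and> c \<le> \<beta> (Suc n) * \<tau> (Suc n) * \<tau> n)"
begin

definition growth :: "nat \<Rightarrow> real" where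
  "growth n = \<gamma> * ((\<psi> - \<phi>) / (\<psi> + \<phi> * \<gamma> * \<tau> n)) * \<tau> n"

definition u :: "nat \<Rightarrow> real" where "u n = sqrt (\<beta> n)"

text \<open>The step size in units of 1 / sqrt \<beta>. In this scale the backtracking bound on
  \<beta> \<tau> \<tau>' becomes a bound on the product of two consecutive values, with a constant
  independent of n.\<close>

definition s :: "nat \<Rightarrow> real" where "s n = \<tau> n * u n"

lemma \<psi>_pos: "0 < \<psi>" using \<phi> by simp

lemma denom_pos: "0 < \<psi> + \<phi> * \<gamma> * \<tau> n"
  using \<gamma> \<phi> \<tau>_pos[of n] \<psi>_pos by (intro add_pos_pos mult_pos_pos) auto

lemma growth_pos: "0 < growth n"
  unfolding growth_def using \<gamma> \<phi> \<tau>_pos[of n] denom_pos[of n]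
  by (intro mult_pos_pos divide_pos_pos) auto

text \<open>As \<omega> decays like 1 / \<tau>, the growth saturates: one step multiplies \<beta> by
  a bounded factor however large \<tau> is. The constants \<Theta> and \<open>c'\<close> rest on
  this.\<close>

lemma growth_le: "growth n \<le> \<psi> / \<phi>"
proof -
  have "growth n * (\<phi> * (\<psi> + \<phi> * \<gamma> * \<tau> n)) \<le> \<psi> * (\<psi> + \<phi> * \<gamma> * \<tau> n)"
  proof -
    have "growth n * (\<phi> * (\<psi> + \<phi> * \<gamma> * \<tau> n)) = \<phi> * \<gamma> * (\<psi> - \<phi>) * \<tau> n"
      unfolding growth_def using denom_pos[of n] by (simp add: field_simps)
    also have "\<dots> = \<phi> * \<gamma> * \<tau> n * (\<psi> - \<phi>)" by simp
    also have "\<dots> \<le> \<phi> * \<gamma> * \<tau> n * \<psi>"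
      using \<gamma> \<phi> \<tau>_pos[of n] by (intro mult_left_mono) auto
    also have "\<dots> \<le> \<psi> * (\<psi> + \<phi> * \<gamma> * \<tau> n)" using \<psi>_pos by (simp add: algebra_simps)
    finally show ?thesis .
  qed
  then have "growth n * \<phi> * (\<psi> + \<phi> * \<gamma> * \<tau> n) \<le> \<psi> * (\<psi> + \<phi> * \<gamma> * \<tau> n)"
    by (simp add: mult.assoc)
  then have "growth n * \<phi> \<le> \<psi>" using denom_pos[of n] by simp
  then show ?thesis using \<phi> by (simp add: field_simps)
qed

lemma growth_le_linear: "growth n \<le> \<gamma> * \<tau> n"
proof -
  have "(\<psi> - \<phi>) / (\<psi> + \<phi> * \<gamma> * \<tau> n) \<le> 1"
    using denom_pos[of n] \<gamma> \<phi> \<tau>_pos[of n] by (simp add: field_simps add_nonneg_nonneg)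
  then have "\<gamma> * \<tau> n * ((\<psi> - \<phi>) / (\<psi> + \<phi> * \<gamma> * \<tau> n)) \<le> \<gamma> * \<tau> n * 1"
    using \<gamma> \<tau>_pos[of n] by (intro mult_left_mono) auto
  then show ?thesis by (simp add: growth_def algebra_simps)
qed

lemma growth_ge: "\<gamma> * (\<psi> - \<phi>) / (\<psi> + \<phi> * \<gamma>) * min (\<tau> n) 1 \<le> growth n"
proof -
  have D: "0 < \<psi> + \<phi> * \<gamma>" using \<gamma> \<phi> \<psi>_pos by (intro add_pos_pos) auto
  have "min (\<tau> n) 1 * (\<psi> + \<phi> * \<gamma> * \<tau> n) \<le> \<tau> n * (\<psi> + \<phi> * \<gamma>)"
  proof (cases "\<tau> n \<le> 1")
    case True
    then have "\<tau> n * (\<psi> + \<phi> * \<gamma> * \<tau> n) \<le> \<tau> n * (\<psi> + \<phi> * \<gamma> * 1)"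
      using \<gamma> \<phi> \<tau>_pos[of n] by (intro mult_left_mono add_left_mono) auto
    then show ?thesis using True by (simp add: min_def)
  next
    case False
    then show ?thesis using \<psi>_pos by (simp add: min_def algebra_simps)
  qed
  then have "min (\<tau> n) 1 / (\<psi> + \<phi> * \<gamma>) \<le> \<tau> n / (\<psi> + \<phi> * \<gamma> * \<tau> n)"
    using D denom_pos[of n] by (simp add: divide_simps)
  then have "\<gamma> * (\<psi> - \<phi>) * (min (\<tau> n) 1 / (\<psi> + \<phi> * \<gamma>)) \<le> \<gamma> * (\<psi> - \<phi>) * (\<tau> n / (\<psi> + \<phi> * \<gamma> * \<tau> n))"
    using \<gamma> \<phi> by (intro mult_left_mono) auto
  then show ?thesis by (simp add: growth_def)
qed

lemma \<beta>_growth: "\<beta> (Suc n) = \<beta> n * (1 + growth n)"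
  by (simp add: \<beta>_Suc growth_def)

lemma \<beta>_pos: "0 < \<beta> n"
proof (induction n)
  case (Suc n)
  then show ?case using growth_pos[of n] by (simp add: \<beta>_growth)
qed (rule \<beta>_0)

lemma u_pos: "0 < u n" by (simp add: u_def \<beta>_pos)

lemma s_pos: "0 < s n" by (simp add: s_def u_pos \<tau>_pos)

lemma u_squared: "u n * u n = \<beta> n" using \<beta>_pos[of n] by (simp add: u_def)

lemma u_Suc: "u (Suc n) = u n * sqrt (1 + growth n)"
  by (simp add: u_def \<beta>_growth real_sqrt_mult)

lemma u_mono: "u n \<le> u (Suc n)"
  using u_pos[of n] growth_pos[of n] by (simp add: u_Suc)

lemma u_ge: "u 0 \<le> u n"
  using lift_Suc_mono_le[of u 0 n] u_mono by simp

lemma \<tau>_Suc_le: "\<tau> (Suc n) \<le> \<phi> * \<tau> n" using \<tau>_Suc[of n] by auto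

definition \<Theta> :: real where "\<Theta> = \<phi> * sqrt (1 + \<psi> / \<phi>)"

lemma \<Theta>_pos: "0 < \<Theta>" using \<phi> by (simp add: \<Theta>_def add_pos_pos)

lemma s_Suc_le: "s (Suc n) \<le> \<Theta> * s n"
proof -
  have "s (Suc n) = \<tau> (Suc n) * sqrt (1 + growth n) * u n" by (simp add: s_def u_Suc)
  also have "\<dots> \<le> (\<phi> * \<tau> n) * sqrt (1 + \<psi> / \<phi>) * u n"
    using \<tau>_Suc_le[of n] growth_le[of n] growth_pos[of n] u_pos[of n] \<phi> \<tau>_pos[of n] \<tau>_pos[of "Suc n"]
    by (intro mult_mono) auto
  finally show ?thesis by (simp add: \<Theta>_def s_def algebra_simps)
qed

definition c' :: real where "c' = c / sqrt (1 + \<psi> / \<phi>)"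

lemma c'_pos: "0 < c'" using c \<phi> by (simp add: c'_def add_pos_pos)

text \<open>The backtracking bound pairs \<open>\<tau> n\<close> with \<open>u (Suc n)\<close>
  instead of \<open>u n\<close>; the quotient of the two, at most
  \<open>sqrt (1 + \<psi> / \<phi>)\<close>, is absorbed into \<open>c'\<close>.\<close>

lemma s_Suc: "\<phi> * s n \<le> s (Suc n) \<or> c' \<le> s (Suc n) * s n"
proof (rule disjE[OF \<tau>_Suc[of n]])
  assume "\<tau> (Suc n) = \<phi> * \<tau> n"
  then have "\<phi> * s n \<le> s (Suc n)"
    using u_mono[of n] \<phi> \<tau>_pos[of n] by (simp add: s_def)
  then show ?thesis ..
next
  assume *: "\<tau> (Suc n) \<le> \<phi> * \<tau> n \<and> c \<le> \<beta> (Suc n) * \<tau> (Suc n) * \<tau> n"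
  have eq: "\<beta> (Suc n) * \<tau> (Suc n) * \<tau> n = sqrt (1 + growth n) * (s (Suc n) * s n)"
    using u_squared[of "Suc n"] u_Suc[of n] by (simp add: s_def flip: u_squared)
  have "c \<le> sqrt (1 + growth n) * (s (Suc n) * s n)" using * eq by simp
  also have "\<dots> \<le> sqrt (1 + \<psi> / \<phi>) * (s (Suc n) * s n)"
    using growth_le[of n] s_pos[of n] s_pos[of "Suc n"] by (intro mult_right_mono) auto
  finally have "c' \<le> s (Suc n) * s n"
    unfolding c'_def using \<phi> by (simp add: divide_le_eq add_pos_pos algebra_simps)
  then show ?thesis ..
qed

section \<open>Linear growth of the square root of \<beta>\<close>

definition \<kappa> :: real where "\<kappa> = \<gamma> * (\<psi> - \<phi>) / (\<psi> + \<phi> * \<gamma>) / (\<psi> / \<phi> + 2)"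

lemma \<kappa>_pos: "0 < \<kappa>"
  unfolding \<kappa>_def using \<gamma> \<phi> \<psi>_pos by (intro divide_pos_pos mult_pos_pos add_pos_pos) auto

lemma u_increment: "u n + \<kappa> * min (s n) (u n) \<le> u (Suc n)"
proof -
  \<comment> \<open>For 0 <= t <= M - 2 one has (1 + t / M)^2 <= 1 + t, because (M - 2) (M - 1) >=
    0. The square root is thus bounded below by a line of slope 1 / M on the range of
    \<open>growth\<close>.\<close>
  define M where "M = \<psi> / \<phi> + 2"
  have M: "2 < M" using \<phi> \<psi>_pos by (simp add: M_def)
  have "2 * M + growth n \<le> M * M"
  proof -
    have "growth n \<le> M - 2" using growth_le[of n] by (simp add: M_def)
    moreover have "0 \<le> (M - 2) * (M - 1)" using M by simp
    ultimately show ?thesis by (simp add: algebra_simps)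
  qed
  then have "growth n * (2 * M + growth n) \<le> growth n * (M * M)"
    using growth_pos[of n] by (intro mult_left_mono) auto
  then have "(1 + growth n / M)\<^sup>2 \<le> 1 + growth n"
    using M by (simp add: field_simps power2_eq_square)
  then have "1 + growth n / M \<le> sqrt (1 + growth n)" by (rule real_le_rsqrt)
  moreover have "\<kappa> * min (\<tau> n) 1 \<le> growth n / M"
    using growth_ge[of n] M unfolding \<kappa>_def M_def[symmetric] by (simp add: divide_simps)
  ultimately have "u n * (1 + \<kappa> * min (\<tau> n) 1) \<le> u n * sqrt (1 + growth n)"
    using u_pos[of n] by (intro mult_left_mono) auto
  then have "u n + u n * (\<kappa> * min (\<tau> n) 1) \<le> u (Suc n)"
    by (simp only: u_Suc distrib_left mult_1_right)
  moreover have "u n * min (\<tau> n) 1 = min (s n) (u n)"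
    using u_pos[of n] by (auto simp: s_def min_def)
  then have "u n * (\<kappa> * min (\<tau> n) 1) = \<kappa> * min (s n) (u n)"
    by (metis mult.left_commute)
  ultimately show ?thesis by linarith
qed

text \<open>While \<open>\<tau> > 1\<close> both \<open>\<tau>\<close> and \<open>u\<close> grow geometrically, so a large \<open>\<tau>\<close> forces a large \<open>u\<close>.\<close>
lemma ln_\<tau>_le: "\<exists>A B. 0 \<le> A \<and> 0 \<le> B \<and> (\<forall>n. ln (\<tau> n) \<le> A * u n + B)"
proof (intro exI conjI allI)
  \<comment> \<open>While \<tau> > 1 a step adds at most \<open>ln \<phi>\<close> to
    \<open>ln (\<tau> n)\<close> and at least \<open>\<kappa> * u 0\<close> to \<open>u n\<close>;
    \<open>A\<close> is the ratio. After a step with \<tau> <= 1 the constant \<open>B\<close>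
    suffices.\<close>
  define A where "A = ln \<phi> / (\<kappa> * u 0)"
  define B where "B = ln \<phi> + \<bar>ln (\<tau> 0)\<bar>"
  have l: "0 < ln \<phi>" using \<phi> by simp
  show A: "0 \<le> A" using l \<kappa>_pos u_pos[of 0] by (simp add: A_def)
  show "0 \<le> B" using l by (simp add: B_def)
  show "ln (\<tau> n) \<le> A * u n + B" for n
  proof (induction n)
    case 0
    have "0 \<le> A * u 0" using A u_pos[of 0] by simp
    then show ?case using l by (simp add: B_def)
  next
    case (Suc n)
    have "ln (\<tau> (Suc n)) \<le> ln (\<phi> * \<tau> n)"
      using \<tau>_Suc_le \<tau>_pos \<phi> by (subst ln_le_cancel_iff) auto
    then have le: "ln (\<tau> (Suc n)) \<le> ln \<phi> + ln (\<tau> n)"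
      using \<phi> \<tau>_pos[of n] by (simp add: ln_mult)
    show ?case
    proof (cases "\<tau> n \<le> 1")
      case True
      then have "ln (\<tau> n) \<le> 0" using \<tau>_pos[of n] by simp
      moreover have "0 \<le> A * u (Suc n)" using A u_pos[of "Suc n"] by simp
      ultimately show ?thesis using le by (simp add: B_def)
    next
      case False
      then have "u n \<le> s n" using u_pos[of n] by (simp add: s_def)
      then have "u n + \<kappa> * u n \<le> u (Suc n)" using u_increment[of n] by (simp add: min_absorb2)
      moreover have "\<kappa> * u 0 \<le> \<kappa> * u n" using \<kappa>_pos u_ge[of n] by simp
      ultimately have "A * (u n + \<kappa> * u 0) \<le> A * u (Suc n)"
        using A by (intro mult_left_mono) auto
      moreover have "A * (\<kappa> * u 0) = ln \<phi>"
        using \<kappa>_pos u_pos[of 0] by (simp add: A_def)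
      ultimately show ?thesis using le Suc by (simp add: algebra_simps)
    qed
  qed
qed

text \<open>There is one bound for each argument of the minimum: the logarithm is below the
  identity, and \<open>ln (s n)\<close> is \<open>ln (\<tau> n) + ln (u n)\<close>, where
  \<open>ln_\<tau>_le\<close> controls the first summand. The constant is absorbed through
  \<open>u 0 \<le> u n\<close>.\<close>

lemma ln_s_le: "\<exists>A\<ge>1. \<forall>n. ln (s n) \<le> A * min (s n) (u n)"
proof -
  obtain A B where AB: "0 \<le> A" "0 \<le> B" "\<And>n. ln (\<tau> n) \<le> A * u n + B"
    using ln_\<tau>_le by blast
  define A' where "A' = A + 1 + B / u 0"
  have A': "1 \<le> A'" using AB u_pos[of 0] by (simp add: A'_def)
  have "ln (s n) \<le> A' * min (s n) (u n)" for n
  proof -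
    have "ln (s n) \<le> s n" using ln_less_self[OF s_pos[of n]] by simp
    also have "s n \<le> A' * s n" using A' s_pos[of n] by simp
    finally have 1: "ln (s n) \<le> A' * s n" .
    have "ln (s n) = ln (\<tau> n) + ln (u n)" using \<tau>_pos[of n] u_pos[of n] by (simp add: s_def ln_mult)
    also have "\<dots> \<le> A * u n + B + u n" using AB(3)[of n] ln_less_self[OF u_pos[of n]] by simp
    also have "B \<le> B / u 0 * u n"
    proof -
      have "B / u 0 * u 0 \<le> B / u 0 * u n"
        using AB(2) u_pos[of 0] u_ge[of n] by (intro mult_left_mono) auto
      then show ?thesis using u_pos[of 0] by simp
    qed
    finally have "ln (s n) \<le> A' * u n" by (simp add: A'_def algebra_simps)
    with 1 show ?thesis by (simp add: min_def)
  qed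
  then show ?thesis using A' by blast
qed

text \<open>A large \<open>s\<close> may be followed by a small one, of size about \<open>1 / s\<close>, after which logarithmically
  many steps bring no increase of \<open>u\<close>. The term \<open>min 0 (ln s)\<close> of the potential pays for these
  steps, and \<open>ln_s_le\<close> shows that its drop is covered by the increase of \<open>u\<close>.\<close>
lemma potential_growth:
  "\<exists>A \<epsilon>. 0 < A \<and> 0 < \<epsilon> \<and>
    (\<forall>n. u n + A * min 0 (ln (s n)) + \<epsilon> \<le> u (Suc n) + A * min 0 (ln (s (Suc n))))"
proof -
  obtain A2 where A2: "1 \<le> A2" "\<And>n. ln (s n) \<le> A2 * min (s n) (u n)"
    using ln_s_le by blast
  \<comment> \<open>\<open>m0\<close> and \<open>m1\<close> are lower bounds for
    \<open>min (s n) (u n)\<close> in the two cases where \<open>u\<close> must pay: after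
    backtracking, where \<Theta> (s n)^2 >= c', and after a rise from \<open>s n\<close> above 1 /
    \<phi>.\<close>
  define m0 where "m0 = min (sqrt (c' / \<Theta>)) (u 0)"
  define m1 where "m1 = min (1 / \<phi>) (u 0)"
  have m: "0 < m0" "0 < m1"
    using c'_pos \<Theta>_pos u_pos[of 0] \<phi> by (auto simp: m0_def m1_def)
  \<comment> \<open>After backtracking, \<open>- ln (s (Suc n))\<close> is at most
    \<open>Q * min (s n) (u n)\<close>. With \<open>A * Q = \<kappa> / 2\<close> the drop of the
    logarithm costs half the increase of \<open>u\<close>; the other half is at least
    \<open>\<kappa> * m0 / 2\<close>.\<close>
  define Q where "Q = \<bar>ln c'\<bar> / m0 + A2"
  have Q: "0 < Q" using A2(1) m by (simp add: Q_def add_nonneg_pos)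
  define A where "A = \<kappa> / (2 * Q)"
  have A: "0 < A" using \<kappa>_pos Q by (simp add: A_def)
  have AQ: "A * Q = \<kappa> / 2" using Q by (simp add: A_def)
  define \<epsilon> where "\<epsilon> = min (A * ln \<phi>) (min (\<kappa> * m1) (\<kappa> * m0 / 2))"
  have l: "0 < ln \<phi>" using \<phi> by simp
  have \<epsilon>: "0 < \<epsilon>" using A l \<kappa>_pos m by (simp add: \<epsilon>_def)
  have "u n + A * min 0 (ln (s n)) + \<epsilon> \<le> u (Suc n) + A * min 0 (ln (s (Suc n)))" for n
  proof (rule disjE[OF s_Suc[of n]])
    assume "\<phi> * s n \<le> s (Suc n)"
    then have "ln (\<phi> * s n) \<le> ln (s (Suc n))"
      using s_pos \<phi> by (subst ln_le_cancel_iff) auto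
    then have ln: "ln \<phi> + ln (s n) \<le> ln (s (Suc n))"
      using \<phi> s_pos[of n] by (simp add: ln_mult)
    show ?thesis
    proof (cases "ln \<phi> + ln (s n) \<le> 0")
      case True
      then have "ln \<phi> + min 0 (ln (s n)) \<le> min 0 (ln (s (Suc n)))" using ln l by (simp add: min_def)
      then have "A * (ln \<phi> + min 0 (ln (s n))) \<le> A * min 0 (ln (s (Suc n)))"
        using A by (intro mult_left_mono) auto
      moreover have "\<epsilon> \<le> A * ln \<phi>" by (simp add: \<epsilon>_def)
      ultimately show ?thesis using u_mono[of n] by (simp add: algebra_simps)
    next
      case False
      then have "0 < ln (\<phi> * s n)" using \<phi> s_pos[of n] by (simp add: ln_mult)
      then have "1 < \<phi> * s n" using \<phi> s_pos[of n] by simp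
      then have "1 / \<phi> \<le> s n" using \<phi> by (simp add: field_simps)
      then have "m1 \<le> min (s n) (u n)" using u_ge[of n] by (auto simp: m1_def)
      then have "\<kappa> * m1 \<le> \<kappa> * min (s n) (u n)" using \<kappa>_pos by (intro mult_left_mono) auto
      moreover have "\<epsilon> \<le> \<kappa> * m1" by (simp add: \<epsilon>_def)
      moreover have "A * min 0 (ln (s n)) \<le> A * min 0 (ln (s (Suc n)))"
        using ln l A by (intro mult_left_mono) auto
      ultimately show ?thesis using u_increment[of n] by linarith
    qed
  next
    assume fall: "c' \<le> s (Suc n) * s n"
    also have "\<dots> \<le> \<Theta> * s n * s n" using s_Suc_le s_pos by (intro mult_right_mono) (auto intro: less_imp_le)
    finally have "c' / \<Theta> \<le> (s n)\<^sup>2" using \<Theta>_pos by (simp add: field_simps power2_eq_square)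
    then have "sqrt (c' / \<Theta>) \<le> s n" using s_pos[of n] by (intro real_le_lsqrt) auto
    then have m_ge: "m0 \<le> min (s n) (u n)" using u_ge[of n] by (auto simp: m0_def)
    have "ln c' \<le> ln (s (Suc n) * s n)"
      using fall c'_pos s_pos by (subst ln_le_cancel_iff) auto
    then have "ln c' \<le> ln (s (Suc n)) + ln (s n)" using s_pos by (simp add: ln_mult_pos)
    then have "- \<bar>ln c'\<bar> - A2 * min (s n) (u n) \<le> ln (s (Suc n))" using A2(2)[of n] by linarith
    moreover have "\<bar>ln c'\<bar> \<le> \<bar>ln c'\<bar> / m0 * min (s n) (u n)"
    proof -
      have "\<bar>ln c'\<bar> / m0 * m0 \<le> \<bar>ln c'\<bar> / m0 * min (s n) (u n)"
        using m_ge m by (intro mult_left_mono) auto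
      then show ?thesis using m by simp
    qed
    ultimately have "- (Q * min (s n) (u n)) \<le> ln (s (Suc n))"
      by (simp add: Q_def algebra_simps)
    moreover have "0 \<le> Q * min (s n) (u n)" using Q m m_ge by simp
    ultimately have "- (Q * min (s n) (u n)) \<le> min 0 (ln (s (Suc n)))" by simp
    then have "A * (- (Q * min (s n) (u n))) \<le> A * min 0 (ln (s (Suc n)))"
      using A by (intro mult_left_mono) auto
    then have "- (\<kappa> / 2 * min (s n) (u n)) \<le> A * min 0 (ln (s (Suc n)))"
      using AQ by (simp add: algebra_simps flip: mult.assoc)
    moreover have "A * min 0 (ln (s n)) \<le> 0" using A by (simp add: mult_le_0_iff)
    moreover have "\<kappa> * m0 / 2 \<le> \<kappa> / 2 * min (s n) (u n)" using \<kappa>_pos m_ge by simp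
    moreover have "\<epsilon> \<le> \<kappa> * m0 / 2" by (simp add: \<epsilon>_def)
    ultimately show ?thesis using u_increment[of n] by (simp add: algebra_simps)
  qed
  then show ?thesis using A \<epsilon> by blast
qed

lemma u_linear_growth: "\<exists>d>0. \<forall>n. d * real n \<le> u n"
proof -
  obtain A \<epsilon> where A: "0 < A" and \<epsilon>: "0 < \<epsilon>"
    and step: "\<And>n. u n + A * min 0 (ln (s n)) + \<epsilon> \<le> u (Suc n) + A * min 0 (ln (s (Suc n)))"
    using potential_growth by blast
  define B where "B = - (A * min 0 (ln (s 0)))"
  have B: "0 \<le> B" using A by (simp add: B_def mult_le_0_iff)
  have "u 0 - B + \<epsilon> * real n \<le> u n + A * min 0 (ln (s n))" for n
  proof (induction n)
    case (Suc n)
    then show ?case using step[of n] by (simp add: algebra_simps)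
  qed (simp add: B_def)
  moreover have "A * min 0 (ln (s n)) \<le> 0" for n using A by (simp add: mult_le_0_iff)
  ultimately have "\<epsilon> * real n \<le> u n + B" for n
    using u_pos[of 0] by (smt (verit))
  then have "\<epsilon> * real n / (1 + B / u 0) \<le> u n" for n
    using linear_lower_bound[OF u_pos[of 0] u_ge B] by blast
  moreover have "0 < \<epsilon> / (1 + B / u 0)" using \<epsilon> B u_pos[of 0] by (simp add: add_pos_nonneg)
  ultimately show ?thesis by (intro exI[of _ "\<epsilon> / (1 + B / u 0)"]) simp
qed

lemma \<beta>_quadratic_growth: "\<exists>d>0. \<forall>n. d * (real n)\<^sup>2 \<le> \<beta> n"
proof -
  obtain d where d: "d > 0" "\<And>n. d * real n \<le> u n" using u_linear_growth by blast
  have "d\<^sup>2 * (real n)\<^sup>2 \<le> \<beta> n" for n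
  proof -
    have "(d * real n)\<^sup>2 \<le> (u n)\<^sup>2" using d by (intro power_mono) auto
    then show ?thesis using u_squared[of n] by (simp add: power2_eq_square ac_simps)
  qed
  then show ?thesis using d(1) by (intro exI[of _ "d\<^sup>2"]) simp
qed

text \<open>The increment of \<beta> at step n is at most \<gamma> times the weight
  \<open>\<beta> n * \<tau> n\<close>, so telescoping transfers the growth of \<beta> to the sum of
  the weights.\<close>

lemma sum_weights_quadratic_growth:
  "\<exists>d>0. \<forall>N\<ge>1. d * (real N)\<^sup>2 \<le> (\<Sum>n=1..N. \<beta> n * \<tau> n)"
proof -
  obtain d where d: "d > 0" "\<And>n. d * (real n)\<^sup>2 \<le> \<beta> n" using \<beta>_quadratic_growth by blast
  define S where "S = (\<lambda>N. \<Sum>n=1..N. \<beta> n * \<tau> n)"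
  have nn: "0 \<le> \<beta> n * \<tau> n" for n using \<beta>_pos[of n] \<tau>_pos[of n] by simp
  have low: "\<beta> (Suc N) - \<beta> 1 \<le> \<gamma> * S N" for N
  proof (induction N)
    case (Suc N)
    have "\<beta> (Suc N) * growth (Suc N) \<le> \<beta> (Suc N) * (\<gamma> * \<tau> (Suc N))"
      using \<beta>_pos[of "Suc N"] growth_le_linear[of "Suc N"] by (intro mult_left_mono) auto
    then have "\<beta> (Suc (Suc N)) \<le> \<beta> (Suc N) + \<gamma> * (\<beta> (Suc N) * \<tau> (Suc N))"
      by (simp add: \<beta>_growth[of "Suc N"] algebra_simps)
    then show ?case using Suc by (simp add: S_def algebra_simps)
  qed (simp add: S_def)
  have S1: "\<beta> 1 * \<tau> 1 \<le> S N" if "N \<ge> 1" for N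
    unfolding S_def using that nn by (intro member_le_sum) auto
  define b B where "b = \<beta> 1 * \<tau> 1" and "B = \<beta> 1 / \<gamma>"
  have b: "0 < b" using \<beta>_pos \<tau>_pos by (simp add: b_def)
  have B: "0 \<le> B" using \<beta>_pos[of 1] \<gamma> by (simp add: B_def)
  have "d / \<gamma> / (1 + B / b) * (real N)\<^sup>2 \<le> S N" if N: "N \<ge> 1" for N
  proof -
    have "d * (real N)\<^sup>2 \<le> d * (real (Suc N))\<^sup>2" using d(1) by (intro mult_left_mono power_mono) auto
    also have "\<dots> \<le> \<gamma> * S N + \<beta> 1" using low[of N] d(2)[of "Suc N"] by linarith
    finally have "d / \<gamma> * (real N)\<^sup>2 \<le> S N + B" using \<gamma> by (simp add: B_def field_simps)
    from linear_lower_bound[OF b S1[OF N, folded b_def] B this] show ?thesis by simp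
  qed
  moreover have "0 < d / \<gamma> / (1 + B / b)" using d(1) \<gamma> B b by (simp add: add_pos_nonneg)
  ultimately show ?thesis unfolding S_def by blast
qed

text \<open>If \<open>s\<close> stayed small it would grow geometrically. It first exceeds a small threshold by at
  most the factor \<open>\<Theta>\<close>, so that the next value cannot fall below the threshold.\<close>
lemma frequently_large_pair: "\<exists>\<sigma>>0. \<forall>N. \<exists>n\<ge>N. \<sigma> \<le> s n \<and> \<sigma> \<le> s (Suc n)"
proof -
  \<comment> \<open>The factor 1 / 2 makes \<Theta> \<sigma>^2 < c' strict. Hence a value below
    \<sigma> excludes the backtracking alternative, and after a value between \<sigma> and \<Theta>
    \<sigma> that alternative still leaves the next one above \<sigma>.\<close>
  define \<sigma> where "\<sigma> = sqrt (c' / \<Theta>) / 2"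
  have \<sigma>: "0 < \<sigma>" using c'_pos \<Theta>_pos by (simp add: \<sigma>_def)
  have \<sigma>2: "\<Theta> * \<sigma>\<^sup>2 < c'"
    using c'_pos \<Theta>_pos by (simp add: \<sigma>_def power_divide)
  have "\<exists>n\<ge>N. \<sigma> \<le> s n \<and> \<sigma> \<le> s (Suc n)" for N
  proof -
    have rise: "\<phi> * s n \<le> s (Suc n)" if "s n < \<sigma>" for n
    proof (rule ccontr)
      assume "\<not> \<phi> * s n \<le> s (Suc n)"
      then have "c' \<le> s (Suc n) * s n" using s_Suc[of n] by blast
      also have "\<dots> \<le> \<Theta> * s n * s n"
        using s_Suc_le s_pos by (intro mult_right_mono) (auto intro: less_imp_le)
      also have "\<dots> = \<Theta> * (s n)\<^sup>2" by (simp add: power2_eq_square)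
      also have "\<dots> \<le> \<Theta> * \<sigma>\<^sup>2"
        using that s_pos[of n] \<Theta>_pos by (intro mult_left_mono power_mono) auto
      finally show False using \<sigma>2 by simp
    qed
    have reach: "\<exists>k. \<sigma> \<le> s (m + k)" for m
    proof (rule ccontr)
      assume "\<not> ?thesis"
      then have small: "s (m + k) < \<sigma>" for k by (meson not_le)
      have "\<phi> ^ k * s m \<le> s (m + k)" for k
      proof (induction k)
        case (Suc k)
        have "\<phi> * (\<phi> ^ k * s m) \<le> \<phi> * s (m + k)" using Suc \<phi> by (intro mult_left_mono) auto
        also have "\<dots> \<le> s (m + Suc k)" using rise small by simp
        finally show ?case by (simp add: algebra_simps)
      qed simp
      moreover obtain k where "\<sigma> / s m < \<phi> ^ k" using real_arch_pow[OF \<phi>(1)] by blast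
      then have "\<sigma> < \<phi> ^ k * s m" using s_pos[of m] by (simp add: divide_less_eq)
      ultimately show False using small[of k] by (smt (verit))
    qed
    show ?thesis
    proof (cases "\<sigma> \<le> s N \<and> \<sigma> \<le> s (Suc N)")
      case True
      then show ?thesis by blast
    next
      case False
      have "\<exists>m\<ge>N. s m < \<sigma>" using False by (metis le_Suc_eq not_le order_refl)
      then obtain m where m: "m \<ge> N" "s m < \<sigma>" by blast
      obtain k where k: "\<sigma> \<le> s (m + k)" "\<And>j. j < k \<Longrightarrow> s (m + j) < \<sigma>"
        using reach[of m] exists_least_iff[of "\<lambda>k. \<sigma> \<le> s (m + k)"] by (auto simp: not_le)
      have "k \<noteq> 0" using k(1) m(2) by (auto intro: ccontr)
      then obtain j where j: "k = Suc j" using not0_implies_Suc by blast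
      define i where "i = m + k"
      have "s i \<le> \<Theta> * s (m + j)" using s_Suc_le[of "m + j"] by (simp add: i_def j)
      also have "\<dots> \<le> \<Theta> * \<sigma>" using k(2)[of j] \<Theta>_pos by (simp add: j)
      finally have up: "s i \<le> \<Theta> * \<sigma>" .
      have lo: "\<sigma> \<le> s i" using k(1) by (simp add: i_def)
      have "\<sigma> \<le> s (Suc i)"
      proof (rule disjE[OF s_Suc[of i]])
        assume "\<phi> * s i \<le> s (Suc i)"
        moreover have "s i \<le> \<phi> * s i" using \<phi> s_pos[of i] by simp
        ultimately show ?thesis using lo by linarith
      next
        assume "c' \<le> s (Suc i) * s i"
        also have "\<dots> \<le> s (Suc i) * (\<Theta> * \<sigma>)" using up s_pos[of "Suc i"] by (intro mult_left_mono) auto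
        finally have "\<Theta> * \<sigma>\<^sup>2 < s (Suc i) * (\<Theta> * \<sigma>)" using \<sigma>2 by simp
        then have "(\<Theta> * \<sigma>) * \<sigma> < (\<Theta> * \<sigma>) * s (Suc i)" by (simp add: power2_eq_square algebra_simps)
        then show ?thesis using \<Theta>_pos \<sigma> by simp
      qed
      then show ?thesis using lo m(1) by (intro exI[of _ i]) (simp add: i_def)
    qed
  qed
  then show ?thesis using \<sigma> by blast
qed

end

section \<open>The accelerated golden ratio iteration\<close>

text \<open>\<open>psi0\<close> is a definite description, so the real root must be unique: the
  cubic is negative up to 1, strictly increasing beyond, and changes sign on [1, 2].\<close>

lemma psi0_root: "psi0 ^ 3 - psi0 - 1 = 0" "1 < psi0"
proof -
  define p :: "real \<Rightarrow> real" where "p = (\<lambda>r. r ^ 3 - r - 1)"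
  have p_mono: "p a < p b" if "1 \<le> a" "a < b" for a b
  proof -
    have "0 < (b - a) * (b\<^sup>2 + a * b + a\<^sup>2 - 1)"
    proof (intro mult_pos_pos)
      have "1 \<le> a * b" "0 < b\<^sup>2" "0 \<le> a\<^sup>2" using that mult_mono[of 1 a 1 b] by simp_all
      then show "0 < b\<^sup>2 + a * b + a\<^sup>2 - 1" by linarith
    qed (use that in simp)
    then show ?thesis by (simp add: p_def power3_eq_cube power2_eq_square algebra_simps)
  qed
  have p_neg: "p r < 0" if "r \<le> 1" for r
  proof (cases "r \<ge> 0")
    case True
    then have "r ^ 3 \<le> r" using that power_decreasing[of 1 3 r] by simp
    then show ?thesis by (simp add: p_def)
  next
    case False
    show ?thesis
    proof (cases "r \<ge> -1")
      case True
      have "r ^ 3 < 0" using False by (simp add: power3_eq_cube mult_less_0_iff zero_less_mult_iff)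
      then show ?thesis using True unfolding p_def by linarith
    next
      case False
      then have "r * r\<^sup>2 \<le> r * 1" by (intro mult_left_mono_neg) (auto simp: power2_ge_1_iff)
      then have "r ^ 3 \<le> r" by (simp add: power3_eq_cube power2_eq_square mult.assoc)
      then show ?thesis by (simp add: p_def)
    qed
  qed
  have "\<exists>r\<ge>1. r \<le> 2 \<and> p r = 0"
    by (rule IVT') (auto simp: p_def intro!: continuous_intros)
  then obtain r where r: "r \<ge> 1" "p r = 0" by blast
  have unique: "q = r" if "p q = 0" for q
    using that r p_neg[of q] p_mono[of q r] p_mono[of r q] by (cases "q \<le> 1"; cases q r rule: linorder_cases) auto
  have "p = (\<lambda>r. r ^ 3 - r - 1)" by (rule p_def)
  then have "psi0 = (THE r. p r = 0)" by (simp add: psi0_def)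
  also have "\<dots> = r" using r(2) unique by (rule the_equality)
  finally have "psi0 = r" .
  then show "psi0 ^ 3 - psi0 - 1 = 0" "1 < psi0"
    using r p_neg[of r] by (auto simp: p_def not_le[symmetric])
qed

text \<open>Each end of the range of \<psi> gives one bound: \<psi> > psi0 means \<psi>^3 > 1 +
  \<psi>, that is \<phi> < \<psi>, and \<psi> below the golden ratio means \<psi>^2 < 1 + \<psi>,
  that is \<phi> > 1.\<close>

lemma varphi_of_bounds:
  assumes "psi0 < \<psi>" "\<psi> < golden_ratio"
  shows "1 < varphi_of \<psi>" "varphi_of \<psi> < \<psi>" "1 < \<psi>"
proof -
  show \<psi>: "1 < \<psi>" using assms psi0_root by simp
  have "0 < (\<psi> - psi0) * (\<psi>\<^sup>2 + \<psi> * psi0 + psi0\<^sup>2 - 1)"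
  proof (intro mult_pos_pos)
    have "1 \<le> \<psi> * psi0" "0 < \<psi>\<^sup>2" "0 \<le> psi0\<^sup>2"
      using psi0_root \<psi> mult_mono[of 1 \<psi> 1 psi0] by auto
    then show "0 < \<psi>\<^sup>2 + \<psi> * psi0 + psi0\<^sup>2 - 1" by linarith
  qed (use assms in simp)
  then have "psi0 ^ 3 - psi0 < \<psi> ^ 3 - \<psi>"
    by (simp add: power3_eq_cube power2_eq_square algebra_simps)
  then have "1 + \<psi> < \<psi> ^ 3" using psi0_root by simp
  then show "varphi_of \<psi> < \<psi>"
    using \<psi> by (simp add: varphi_of_def divide_less_eq power3_eq_cube power2_eq_square mult.assoc)
  have "2 * \<psi> - 1 < sqrt 5" using assms(2) by (simp add: golden_ratio_def)
  then have "(2 * \<psi> - 1)\<^sup>2 < (sqrt 5)\<^sup>2" using \<psi> by (intro power_strict_mono) auto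
  then have "\<psi>\<^sup>2 < 1 + \<psi>" by (simp add: power2_eq_square algebra_simps)
  then show "1 < varphi_of \<psi>" using \<psi> by (simp add: varphi_of_def)
qed

text \<open>The test holds for any dual increment, whatever point the proximal map returns. Hence
  the search ends, and a rejected step has a lower bound.\<close>

lemma linesearch_ok_small_step:
  assumes L: "\<And>v. norm (adjoint K v) \<le> L * norm v" and K: "linear K"
    and "0 \<le> L" "0 \<le> b * t" "b * t * L\<^sup>2 \<le> \<psi> / tprev"
  shows "linesearch_ok f K \<psi> x yprev b tprev t"
proof -
  define d where "d = dual_step f K x yprev b t - yprev"
  have "sqrt (b * t) * L = sqrt (b * t * L\<^sup>2)" using assms(3) by (simp add: real_sqrt_mult)
  also have "\<dots> \<le> sqrt (\<psi> / tprev)" using assms(5) by simp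
  finally have le: "sqrt (b * t) * L \<le> sqrt (\<psi> / tprev)" .
  have "sqrt (b * t) * norm (adjoint K d) \<le> sqrt (b * t) * (L * norm d)"
    using L assms(4) by (intro mult_left_mono) auto
  also have "\<dots> = sqrt (b * t) * L * norm d" by simp
  also have "\<dots> \<le> sqrt (\<psi> / tprev) * norm d"
    using le by (intro mult_right_mono) auto
  finally show ?thesis
    unfolding linesearch_ok_def Let_def d_def
    by (simp add: linear_diff[OF adjoint_linear[OF K]])
qed

lemma norm_convex_combination:
  fixes p q :: "'a::real_inner"
  assumes "a + b = 1"
  shows "(norm (a *\<^sub>R p + b *\<^sub>R q))\<^sup>2 = a * (norm p)\<^sup>2 + b * (norm q)\<^sup>2 - a * b * (norm (p - q))\<^sup>2"
proof -
  have b: "b = 1 - a" using assms by simp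
  show ?thesis
    unfolding power2_norm_eq_inner b by (simp add: inner_commute algebra_simps)
qed

lemma inner_polarization:
  fixes p q r :: "'a::real_inner"
  shows "- 2 * ((p - q) \<bullet> (r - q)) = (norm (p - r))\<^sup>2 - (norm (p - q))\<^sup>2 - (norm (q - r))\<^sup>2"
  unfolding power2_norm_eq_inner by (simp add: inner_commute algebra_simps)

text \<open>The reference saddle point is a parameter, and \<open>f\<close> enters through its
  conjugate alone.\<close>

locale accelerated_grpda =
  fixes g :: "'q::euclidean_space \<Rightarrow> ereal" and f :: "'p::euclidean_space \<Rightarrow> ereal"
    and K :: "'q \<Rightarrow> 'p" and \<gamma> \<psi> \<mu> :: real
    and z x :: "nat \<Rightarrow> 'q" and y :: "nat \<Rightarrow> 'p" and \<beta> \<tau> :: "nat \<Rightarrow> real"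
    and xs :: 'q and ys :: 'p
  assumes g: "closed_proper_convex g" and f': "closed_proper_convex (fenchel_conjugate f)"
    and K: "linear K" and \<gamma>: "0 < \<gamma>" and strong: "strongly_convex \<gamma> g"
    and \<psi>: "psi0 < \<psi>" "\<psi> < golden_ratio" and \<mu>: "0 < \<mu>" "\<mu> < 1"
    and init: "0 < \<beta> 0" "0 < \<tau> 0"
    and iteration: "agrpda_linesearch g f K \<gamma> \<psi> \<mu> z x y \<beta> \<tau>"
    and saddle: "(xs, ys) \<in> saddle_solutions g f K"
begin

abbreviation \<phi> :: real where "\<phi> \<equiv> varphi_of \<psi>"

lemmas \<phi>_gt_1 = varphi_of_bounds(1)[OF \<psi>] and \<phi>_less = varphi_of_bounds(2)[OF \<psi>]
  and \<psi>_gt_1 = varphi_of_bounds(3)[OF \<psi>]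

lemma \<psi>_times_\<phi>: "\<psi> * \<phi> = 1 + 1 / \<psi>"
  using \<psi>_gt_1 by (simp add: varphi_of_def power2_eq_square field_simps)

lemma z_Suc: "z (Suc n) = ((\<psi> - 1) / \<psi>) *\<^sub>R x n + (1 / \<psi>) *\<^sub>R z n"
  and x_Suc: "x (Suc n) = prox (\<tau> n) g (z (Suc n) - \<tau> n *\<^sub>R adjoint K (y n))"
  and \<beta>_Suc: "\<beta> (Suc n) = \<beta> n * (1 + \<gamma> * omega_of \<gamma> \<psi> (\<tau> n) * \<tau> n)"
  and \<tau>_Suc_Least: "\<tau> (Suc n) = \<phi> * \<tau> n * \<mu> ^ (LEAST i. linesearch_ok f K \<psi> (x (Suc n)) (y n)
      (\<beta> (Suc n)) (\<tau> n) (\<phi> * \<tau> n * \<mu> ^ i))"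
  and y_Suc: "y (Suc n) = dual_step f K (x (Suc n)) (y n) (\<beta> (Suc n)) (\<tau> (Suc n))"
  using iteration[unfolded agrpda_linesearch_def One_nat_def, THEN conjunct2, rule_format,
      OF Suc_leI[OF zero_less_Suc[of n]]]
  by (simp_all only: diff_Suc_Suc diff_zero)

lemma \<tau>_pos: "0 < \<tau> n"
  by (induction n) (use init \<mu> \<phi>_gt_1 in \<open>auto simp: \<tau>_Suc_Least\<close>)

lemma \<beta>_pos: "0 < \<beta> n"
proof (induction n)
  case (Suc n)
  have "0 < \<gamma> * omega_of \<gamma> \<psi> (\<tau> n) * \<tau> n"
    unfolding omega_of_def using \<gamma> \<tau>_pos[of n] \<phi>_gt_1 \<phi>_less \<psi>_gt_1
    by (intro mult_pos_pos divide_pos_pos add_pos_pos) auto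
  then show ?case using Suc by (simp add: \<beta>_Suc)
qed (use init in simp)

lemma linesearch:
  obtains c where "0 < c"
    "\<And>n. linesearch_ok f K \<psi> (x (Suc n)) (y n) (\<beta> (Suc n)) (\<tau> n) (\<tau> (Suc n))"
    "\<And>n. \<tau> (Suc n) = \<phi> * \<tau> n \<or>
      (\<tau> (Suc n) \<le> \<phi> * \<tau> n \<and> c \<le> \<beta> (Suc n) * \<tau> (Suc n) * \<tau> n)"
proof -
  obtain L where L: "0 < L" "\<And>v. norm (adjoint K v) \<le> L * norm v"
    by (rule linear_bounded_pos[OF adjoint_linear[OF K]]) auto
  \<comment> \<open>The last rejected trial is the accepted step divided by \<mu>, and it violates
    \<open>\<beta> (Suc n) * t * L\<^sup>2 \<le> \<psi> / \<tau> n\<close>.\<close>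
  define c where "c = \<mu> * \<psi> / L\<^sup>2"
  have "0 < c" using \<mu> \<psi>_gt_1 L by (simp add: c_def)
  moreover have "linesearch_ok f K \<psi> (x (Suc n)) (y n) (\<beta> (Suc n)) (\<tau> n) (\<tau> (Suc n)) \<and>
      (\<tau> (Suc n) = \<phi> * \<tau> n \<or>
      (\<tau> (Suc n) \<le> \<phi> * \<tau> n \<and> c \<le> \<beta> (Suc n) * \<tau> (Suc n) * \<tau> n))" for n
  proof -
    define ok where "ok = (\<lambda>t. linesearch_ok f K \<psi> (x (Suc n)) (y n) (\<beta> (Suc n)) (\<tau> n) t)"
    have okI: "ok t" if "0 < t" "\<beta> (Suc n) * t * L\<^sup>2 \<le> \<psi> / \<tau> n" for t
      unfolding ok_def using that L \<beta>_pos[of "Suc n"]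
      by (intro linesearch_ok_small_step[OF _ K, of L]) (auto simp: mult.commute)
    define t where "t = (\<lambda>i. \<phi> * \<tau> n * \<mu> ^ i)"
    define i where "i = (LEAST i. ok (t i))"
    have t_pos: "0 < t i" for i using \<phi>_gt_1 \<tau>_pos \<mu> by (simp add: t_def)
    have \<tau>i: "\<tau> (Suc n) = t i"
      by (simp add: \<tau>_Suc_Least t_def i_def ok_def)
    have "\<exists>j. ok (t j)"
    proof -
      define B where "B = \<beta> (Suc n) * (\<phi> * \<tau> n) * L\<^sup>2"
      have B: "0 < B" using \<beta>_pos \<phi>_gt_1 \<tau>_pos L by (simp add: B_def)
      have "0 < \<psi> / \<tau> n / B" using \<tau>_pos[of n] \<psi>_gt_1 B by simp
      then obtain j where "\<mu> ^ j < \<psi> / \<tau> n / B" using real_arch_pow_inv \<mu> by blast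
      then have "B * \<mu> ^ j \<le> B * (\<psi> / \<tau> n / B)" using B by (intro mult_left_mono) auto
      then have "B * \<mu> ^ j \<le> \<psi> / \<tau> n" using B by simp
      then have "ok (t j)" using t_pos by (intro okI) (auto simp: t_def B_def algebra_simps)
      then show ?thesis ..
    qed
    then have "ok (t i)" unfolding i_def by (rule LeastI_ex)
    moreover have "\<tau> (Suc n) = \<phi> * \<tau> n \<or>
        (\<tau> (Suc n) \<le> \<phi> * \<tau> n \<and> c \<le> \<beta> (Suc n) * \<tau> (Suc n) * \<tau> n)"
    proof (cases i)
      case 0
      then show ?thesis by (simp add: \<tau>i t_def)
    next
      case (Suc j)
      then have "\<not> ok (t j)" using not_less_Least[of j "\<lambda>i. ok (t i)"] by (simp add: i_def)
      then have "\<psi> / \<tau> n < \<beta> (Suc n) * t j * L\<^sup>2" using okI t_pos by force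
      moreover have "\<tau> (Suc n) = \<mu> * t j" by (simp add: \<tau>i Suc t_def)
      ultimately have "c \<le> \<beta> (Suc n) * \<tau> (Suc n) * \<tau> n"
        using \<mu> L \<tau>_pos[of n] by (simp add: c_def field_simps)
      moreover have "\<mu> ^ i \<le> 1" using \<mu> by (intro power_le_one) auto
      then have "\<tau> (Suc n) \<le> \<phi> * \<tau> n"
        using \<phi>_gt_1 \<tau>_pos[of n] by (simp add: \<tau>i t_def mult_le_cancel_left1)
      ultimately show ?thesis by simp
    qed
    ultimately show ?thesis by (simp add: ok_def \<tau>i)
  qed
  ultimately show thesis using that by blast
qed

lemma linesearch_inequality:
  "\<beta> (Suc n) * \<tau> (Suc n) * (norm (adjoint K (y n) - adjoint K (y (Suc n))))\<^sup>2
    \<le> \<psi> / \<tau> n * (norm (y n - y (Suc n)))\<^sup>2"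
proof -
  have "sqrt (\<beta> (Suc n) * \<tau> (Suc n)) * norm (adjoint K (y (Suc n)) - adjoint K (y n))
      \<le> sqrt (\<psi> / \<tau> n) * norm (y (Suc n) - y n)"
    by (rule linesearch) (auto simp: linesearch_ok_def Let_def y_Suc[symmetric])
  then have "(sqrt (\<beta> (Suc n) * \<tau> (Suc n)) * norm (adjoint K (y (Suc n)) - adjoint K (y n)))\<^sup>2
      \<le> (sqrt (\<psi> / \<tau> n) * norm (y (Suc n) - y n))\<^sup>2"
    using \<beta>_pos[of "Suc n"] \<tau>_pos[of "Suc n"] by (intro power_mono) auto
  then show ?thesis
    using \<beta>_pos[of "Suc n"] \<tau>_pos[of "Suc n"] \<tau>_pos[of n] \<psi>_gt_1
    by (simp add: power_mult_distrib norm_minus_commute)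
qed

lemma step_sizes: obtains c where "step_sizes \<gamma> \<psi> \<phi> c \<beta> \<tau>"
proof -
  obtain c where "0 < c" "\<And>n. \<tau> (Suc n) = \<phi> * \<tau> n \<or>
      (\<tau> (Suc n) \<le> \<phi> * \<tau> n \<and> c \<le> \<beta> (Suc n) * \<tau> (Suc n) * \<tau> n)"
    by (rule linesearch) blast
  then have "step_sizes \<gamma> \<psi> \<phi> c \<beta> \<tau>"
    using \<gamma> \<phi>_gt_1 \<phi>_less init \<tau>_pos by unfold_locales (auto simp: \<beta>_Suc omega_of_def)
  then show thesis using that by blast
qed

section \<open>Subgradients at the iterates and the one-step inequality\<close>

lemma adjoint_inner: "adjoint K v \<bullet> w = K w \<bullet> v"
  by (simp add: inner_commute[of "adjoint K v"] adjoint_works[OF K])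

lemma saddle_subgradients:
  "- adjoint K ys \<in> subdifferential g xs" "K xs \<in> subdifferential (fenchel_conjugate f) ys"
  using saddle by (auto simp: saddle_solutions_iff)

definition gxs :: real where "gxs = real_of_ereal (g xs)"
definition fys :: real where "fys = real_of_ereal (fenchel_conjugate f ys)"
text \<open>Real versions of the values, faithful from index 1 on: a proximal point lies in the
  domain, whereas at a starting point outside it the value is the default 0 for infinity.\<close>

definition gx :: "nat \<Rightarrow> real" where "gx n = real_of_ereal (g (x n))"
definition fy :: "nat \<Rightarrow> real" where "fy n = real_of_ereal (fenchel_conjugate f (y n))"

lemma g_xs: "g xs = ereal gxs"
  by (rule subdifferential_finite[OF g saddle_subgradients(1)]) (simp add: gxs_def)

lemma f_ys: "fenchel_conjugate f ys = ereal fys"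
  by (rule subdifferential_finite[OF f' saddle_subgradients(2)]) (simp add: fys_def)

lemma x_subgradient:
  "(1 / \<tau> n) *\<^sub>R (z (Suc n) - x (Suc n)) - adjoint K (y n) \<in> subdifferential g (x (Suc n))"
proof -
  have "(1 / \<tau> n) *\<^sub>R ((z (Suc n) - \<tau> n *\<^sub>R adjoint K (y n)) - x (Suc n)) \<in> subdifferential g (x (Suc n))"
    unfolding x_Suc
  \<comment> \<open>The affine minorant is the subgradient inequality at the saddle point.\<close>
  proof (rule prox_subgradient[OF g \<tau>_pos])
    fix w b assume "g w = ereal b"
    from subdifferential_realD[OF saddle_subgradients(1) g_xs this]
    show "(gxs + adjoint K ys \<bullet> xs) + (- adjoint K ys) \<bullet> w \<le> b" by (simp add: inner_diff_right)
  qed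
  then show ?thesis using \<tau>_pos[of n] by (simp add: scaleR_diff_right algebra_simps)
qed

lemma y_subgradient:
  "(1 / (\<beta> (Suc n) * \<tau> (Suc n))) *\<^sub>R (y n - y (Suc n)) + K (x (Suc n))
    \<in> subdifferential (fenchel_conjugate f) (y (Suc n))"
proof -
  define t where "t = \<beta> (Suc n) * \<tau> (Suc n)"
  have t: "0 < t" using \<beta>_pos \<tau>_pos by (simp add: t_def)
  have "(1 / t) *\<^sub>R ((y n + t *\<^sub>R K (x (Suc n))) - y (Suc n)) \<in> subdifferential (fenchel_conjugate f) (y (Suc n))"
    unfolding y_Suc dual_step_def t_def[symmetric]
  proof (rule prox_subgradient[OF f' t])
    fix w b assume "fenchel_conjugate f w = ereal b"
    from subdifferential_realD[OF saddle_subgradients(2) f_ys this]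
    show "(fys - K xs \<bullet> ys) + K xs \<bullet> w \<le> b" by (simp add: inner_diff_right)
  qed
  then show ?thesis unfolding t_def[symmetric] using t by (simp add: scaleR_diff_right algebra_simps)
qed

lemma g_x: "g (x (Suc n)) = ereal (gx (Suc n))"
  by (rule subdifferential_finite[OF g x_subgradient[of n]]) (simp add: gx_def)

lemma f_y: "fenchel_conjugate f (y (Suc n)) = ereal (fy (Suc n))"
  by (rule subdifferential_finite[OF f' y_subgradient[of n]]) (simp add: fy_def)

definition gap :: "nat \<Rightarrow> real" where
  "gap n = gx n - gxs + adjoint K ys \<bullet> (x n - xs) + (fy n - fys - K xs \<bullet> (y n - ys))"

lemma gap_nonneg: "0 \<le> gap (Suc n)"
  using subdifferential_realD[OF saddle_subgradients(1) g_xs g_x[of n]]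
    subdifferential_realD[OF saddle_subgradients(2) f_ys f_y[of n]]
  by (simp add: gap_def)

text \<open>Three subgradient inequalities are added: at \<open>x (Suc (Suc n))\<close> tested with
  \<open>xs\<close> (the strong one), at \<open>x (Suc n)\<close> tested with
  \<open>x (Suc (Suc n))\<close>, and at \<open>y (Suc n)\<close> tested with \<open>ys\<close>. The
  bilinear terms collapse to one product of a dual and a primal increment, which the linesearch
  controls.\<close>

lemma gap_inequality:
  fixes n
  defines "\<delta> \<equiv> \<tau> (Suc n) / \<tau> n"
  shows "2 * \<tau> (Suc n) * gap (Suc n) \<le>
    (norm (z (Suc (Suc n)) - xs))\<^sup>2 - (1 + \<gamma> * \<tau> (Suc n)) * (norm (x (Suc (Suc n)) - xs))\<^sup>2
    + (\<psi> * \<delta> - 1) * (norm (x (Suc (Suc n)) - z (Suc (Suc n))))\<^sup>2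
    - \<psi> * \<delta> * (norm (x (Suc n) - z (Suc (Suc n))))\<^sup>2
    + ((norm (y n - ys))\<^sup>2 - (norm (y (Suc n) - ys))\<^sup>2) / \<beta> (Suc n)"
proof -
  define t tp b where "t = \<tau> (Suc n)" and "tp = \<tau> n" and "b = \<beta> (Suc n)"
  define x0 x1 z1 y0 y1 where "x0 = x (Suc n)" and "x1 = x (Suc (Suc n))" and "z1 = z (Suc (Suc n))"
    and "y0 = y n" and "y1 = y (Suc n)"
  note abbrs = t_def[symmetric] tp_def[symmetric] b_def[symmetric] x0_def[symmetric] x1_def[symmetric]
    z1_def[symmetric] y0_def[symmetric] y1_def[symmetric]
  have pos: "0 < t" "0 < tp" "0 < b" "0 < \<psi>"
    using \<tau>_pos \<beta>_pos \<psi>_gt_1 by (auto simp: t_def tp_def b_def)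
  have \<delta>: "\<delta> = t / tp" by (simp add: \<delta>_def t_def tp_def)
  have \<psi>\<delta>: "0 < \<psi> * \<delta>" using pos by (simp add: \<delta>)
  have "gx (Suc (Suc n)) + ((1 / t) *\<^sub>R (z1 - x1) - adjoint K y1) \<bullet> (xs - x1)
      + \<gamma> / 2 * (norm (xs - x1))\<^sup>2 \<le> gxs"
    using strongly_convex_realD[OF strong x_subgradient[of "Suc n"] g_x g_xs] unfolding abbrs .
  then have "2 * t * (gx (Suc (Suc n)) + ((1 / t) *\<^sub>R (z1 - x1) - adjoint K y1) \<bullet> (xs - x1)
      + \<gamma> / 2 * (norm (xs - x1))\<^sup>2) \<le> 2 * t * gxs"
    using pos by (intro mult_left_mono) auto
  moreover have "2 * t * (gx (Suc (Suc n)) + ((1 / t) *\<^sub>R (z1 - x1) - adjoint K y1) \<bullet> (xs - x1)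
      + \<gamma> / 2 * (norm (xs - x1))\<^sup>2) = 2 * t * gx (Suc (Suc n)) + 2 * ((z1 - x1) \<bullet> (xs - x1))
      - 2 * t * (adjoint K y1 \<bullet> (xs - x1)) + \<gamma> * t * (norm (x1 - xs))\<^sup>2"
    using pos by (simp add: inner_diff_left[of "(1 / t) *\<^sub>R (z1 - x1)"] distrib_left right_diff_distrib norm_minus_commute)
  ultimately have 1: "2 * t * (gx (Suc (Suc n)) - gxs) \<le> (norm (z1 - xs))\<^sup>2 - (norm (x1 - z1))\<^sup>2
      - (norm (x1 - xs))\<^sup>2 + 2 * t * (adjoint K y1 \<bullet> (xs - x1)) - \<gamma> * t * (norm (x1 - xs))\<^sup>2"
    using inner_polarization[of z1 x1 xs] by (simp add: norm_minus_commute right_diff_distrib)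
  \<comment> \<open>The averaging step rewrites the displacement of the older proximal step around
    the newer centre \<open>z1\<close>, so that both primal inequalities produce distances to the
    same point.\<close>
  have zx: "z (Suc n) - x0 = \<psi> *\<^sub>R (z1 - x0)"
    unfolding z1_def x0_def z_Suc[of "Suc n"] using pos
    by (simp add: scaleR_diff_right scaleR_add_right scaleR_diff_left)
  have "gx (Suc n) + ((1 / tp) *\<^sub>R (\<psi> *\<^sub>R (z1 - x0)) - adjoint K y0) \<bullet> (x1 - x0) \<le> gx (Suc (Suc n))"
    using subdifferential_realD[OF x_subgradient[of n] g_x g_x[of "Suc n"]] unfolding abbrs zx .
  then have "2 * t * (gx (Suc n) + ((1 / tp) *\<^sub>R (\<psi> *\<^sub>R (z1 - x0)) - adjoint K y0) \<bullet> (x1 - x0))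
      \<le> 2 * t * gx (Suc (Suc n))"
    using pos by (intro mult_left_mono) auto
  moreover have "2 * t * (gx (Suc n) + ((1 / tp) *\<^sub>R (\<psi> *\<^sub>R (z1 - x0)) - adjoint K y0) \<bullet> (x1 - x0))
      = 2 * t * gx (Suc n) + \<psi> * \<delta> * (2 * ((z1 - x0) \<bullet> (x1 - x0))) - 2 * t * (adjoint K y0 \<bullet> (x1 - x0))"
    using pos by (simp add: \<delta> inner_diff_left[of "(\<psi> / tp) *\<^sub>R (z1 - x0)"] distrib_left right_diff_distrib)
  moreover have "\<psi> * \<delta> * (2 * ((z1 - x0) \<bullet> (x1 - x0)))
      = - (\<psi> * \<delta> * ((norm (x1 - z1))\<^sup>2 - (norm (x0 - z1))\<^sup>2 - (norm (x1 - x0))\<^sup>2))"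
  proof -
    have *: "2 * ((z1 - x0) \<bullet> (x1 - x0)) = - ((norm (x1 - z1))\<^sup>2 - (norm (x0 - z1))\<^sup>2 - (norm (x1 - x0))\<^sup>2)"
      using inner_polarization[of z1 x0 x1] by (simp add: norm_minus_commute)
    show ?thesis unfolding * by (rule mult_minus_right)
  qed
  ultimately have 2: "2 * t * (gx (Suc n) - gx (Suc (Suc n))) \<le> \<psi> * \<delta> * (norm (x1 - z1))\<^sup>2
      - \<psi> * \<delta> * (norm (x0 - z1))\<^sup>2 - \<psi> * \<delta> * (norm (x1 - x0))\<^sup>2 + 2 * t * (adjoint K y0 \<bullet> (x1 - x0))"
    by (simp add: right_diff_distrib)
  have "fy (Suc n) + ((1 / (b * t)) *\<^sub>R (y0 - y1) + K x0) \<bullet> (ys - y1) \<le> fys"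
    using subdifferential_realD[OF y_subgradient[of n] f_y f_ys] unfolding abbrs .
  then have "2 * t * (fy (Suc n) + ((1 / (b * t)) *\<^sub>R (y0 - y1) + K x0) \<bullet> (ys - y1)) \<le> 2 * t * fys"
    using pos by (intro mult_left_mono) auto
  moreover have "2 * t * (fy (Suc n) + ((1 / (b * t)) *\<^sub>R (y0 - y1) + K x0) \<bullet> (ys - y1))
      = 2 * t * fy (Suc n) + (2 * ((y0 - y1) \<bullet> (ys - y1))) / b + 2 * t * (K x0 \<bullet> (ys - y1))"
    using pos by (simp add: inner_add_left distrib_left)
  moreover have "(2 * ((y0 - y1) \<bullet> (ys - y1))) / b
      = - (((norm (y0 - ys))\<^sup>2 - (norm (y1 - ys))\<^sup>2) / b - (norm (y0 - y1))\<^sup>2 / b)"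
  proof -
    have *: "2 * ((y0 - y1) \<bullet> (ys - y1)) = - ((norm (y0 - ys))\<^sup>2 - (norm (y1 - ys))\<^sup>2 - (norm (y0 - y1))\<^sup>2)"
      using inner_polarization[of y0 y1 ys] by simp
    show ?thesis unfolding * by (simp add: diff_divide_distrib)
  qed
  ultimately have 3: "2 * t * (fy (Suc n) - fys) \<le> ((norm (y0 - ys))\<^sup>2 - (norm (y1 - ys))\<^sup>2) / b
      - (norm (y0 - y1))\<^sup>2 / b - 2 * t * (K x0 \<bullet> (ys - y1))"
    by (simp add: right_diff_distrib)
  define k d e where "k = norm (adjoint K y0 - adjoint K y1)" and "d = norm (x1 - x0)"
    and "e = norm (y0 - y1)"
  have cross: "2 * t * ((adjoint K y0 - adjoint K y1) \<bullet> (x1 - x0)) \<le> \<psi> * \<delta> * d\<^sup>2 + e\<^sup>2 / b"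
  proof -
    have "b * t * k\<^sup>2 \<le> \<psi> / tp * e\<^sup>2"
      using linesearch_inequality[of n] unfolding abbrs k_def e_def .
    then have ls: "t * tp / \<psi> * k\<^sup>2 \<le> e\<^sup>2 / b" using pos by (simp add: field_simps)
    have "(adjoint K y0 - adjoint K y1) \<bullet> (x1 - x0) \<le> k * d"
      unfolding k_def d_def by (rule norm_cauchy_schwarz)
    then have "2 * t * ((adjoint K y0 - adjoint K y1) \<bullet> (x1 - x0)) \<le> 2 * t * (k * d)"
      using pos by (intro mult_left_mono) auto
    \<comment> \<open>Young's inequality, weighted so that the primal part is exactly the negative
      term available in inequality \<open>2\<close>; the linesearch bounds the dual part by the
      negative term of \<open>3\<close>.\<close>
    also have "\<dots> \<le> \<psi> * \<delta> * d\<^sup>2 + t * tp / \<psi> * k\<^sup>2"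
    proof -
      have "0 \<le> (\<psi> * \<delta> * d - t * k)\<^sup>2 / (\<psi> * \<delta>)" using \<psi>\<delta> by simp
      also have "\<dots> = \<psi> * \<delta> * d\<^sup>2 + t * tp / \<psi> * k\<^sup>2 - 2 * t * (k * d)"
        unfolding \<delta> using pos by (simp add: field_simps power2_eq_square)
      finally show ?thesis by simp
    qed
    finally show ?thesis using ls by simp
  qed
  have "gap (Suc n) = (gx (Suc (Suc n)) - gxs) + (gx (Suc n) - gx (Suc (Suc n))) + (fy (Suc n) - fys)
      + (adjoint K ys \<bullet> (x0 - xs) - K xs \<bullet> (y1 - ys))"
    by (simp add: gap_def abbrs)
  moreover have "adjoint K y1 \<bullet> (xs - x1) + adjoint K y0 \<bullet> (x1 - x0) - K x0 \<bullet> (ys - y1)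
      + (adjoint K ys \<bullet> (x0 - xs) - K xs \<bullet> (y1 - ys)) = (adjoint K y0 - adjoint K y1) \<bullet> (x1 - x0)"
    by (simp add: inner_diff_left inner_diff_right adjoint_inner)
  ultimately have gap: "gap (Suc n) = (gx (Suc (Suc n)) - gxs) + (gx (Suc n) - gx (Suc (Suc n))) + (fy (Suc n) - fys)
      + (adjoint K y0 - adjoint K y1) \<bullet> (x1 - x0) - adjoint K y1 \<bullet> (xs - x1)
      - adjoint K y0 \<bullet> (x1 - x0) + K x0 \<bullet> (ys - y1)"
    by linarith
  have "2 * t * gap (Suc n) = 2 * t * (gx (Suc (Suc n)) - gxs) + 2 * t * (gx (Suc n) - gx (Suc (Suc n)))
      + 2 * t * (fy (Suc n) - fys) + 2 * t * ((adjoint K y0 - adjoint K y1) \<bullet> (x1 - x0))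
      - 2 * t * (adjoint K y1 \<bullet> (xs - x1)) - 2 * t * (adjoint K y0 \<bullet> (x1 - x0)) + 2 * t * (K x0 \<bullet> (ys - y1))"
    unfolding gap by (simp only: distrib_left right_diff_distrib)
  also have "\<dots> \<le> (norm (z1 - xs))\<^sup>2 - (1 + \<gamma> * t) * (norm (x1 - xs))\<^sup>2
      + (\<psi> * \<delta> - 1) * (norm (x1 - z1))\<^sup>2 - \<psi> * \<delta> * (norm (x0 - z1))\<^sup>2
      + ((norm (y0 - ys))\<^sup>2 - (norm (y1 - ys))\<^sup>2) / b"
    using 1 2 3 cross unfolding d_def e_def
    by (simp only: distrib_right left_diff_distrib mult_1_left)
  finally show ?thesis unfolding abbrs .
qed

end

lemma linear_tendsto:
  fixes h :: "'a::euclidean_space \<Rightarrow> 'b::euclidean_space"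
  assumes "linear h" "(p \<longlongrightarrow> l) F"
  shows "((\<lambda>k. h (p k)) \<longlongrightarrow> h l) F"
  using assms linear_conv_bounded_linear bounded_linear.tendsto by blast

section \<open>The energy and its decrease\<close>

context accelerated_grpda
begin

text \<open>The weight is the coefficient 1 + (1 + \<gamma> \<tau>) / (\<psi> - 1), times \<beta>,
  of |z (n + 2) - xs|^2 once \<open>x (Suc (Suc n))\<close> is eliminated in favour of two
  consecutive points \<open>z\<close>.\<close>

definition energy :: "nat \<Rightarrow> real" where
  "energy n = \<beta> (Suc n) * (\<psi> + \<gamma> * \<tau> (Suc n)) / (\<psi> - 1) * (norm (z (Suc (Suc n)) - xs))\<^sup>2
    + (norm (y n - ys))\<^sup>2"

text \<open>A negative term of the one-step inequality, retained because its summability makes the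
  primal optimality residual vanish along suitable indices.\<close>

definition residual :: "nat \<Rightarrow> real" where
  "residual n = \<beta> (Suc n) * \<psi> * (\<tau> (Suc n) / \<tau> n) * (norm (x (Suc n) - z (Suc (Suc n))))\<^sup>2"

lemma residual_nonneg: "0 \<le> residual n"
  unfolding residual_def using \<beta>_pos[of "Suc n"] \<tau>_pos[of "Suc n"] \<tau>_pos[of n] \<psi>_gt_1 by simp

lemma \<tau>_Suc_le: "\<tau> (Suc n) \<le> \<phi> * \<tau> n"
  by (rule linesearch) (metis order_refl)

text \<open>The factor \<open>\<omega>\<close> in the update of \<open>\<beta>\<close> is chosen to make this hold with equality for the
  largest admissible step \<open>\<tau> (Suc n) = \<phi> * \<tau> n\<close>.\<close>
lemma weight_decrease: "\<beta> (Suc n) * (\<psi> + \<gamma> * \<tau> (Suc n)) \<le> \<beta> n * \<psi> * (1 + \<gamma> * \<tau> n)"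
proof -
  have D: "0 < \<psi> + \<phi> * \<gamma> * \<tau> n"
    using \<gamma> \<tau>_pos[of n] \<phi>_gt_1 \<psi>_gt_1 by (intro add_pos_pos mult_pos_pos) auto
  have "\<gamma> * \<tau> (Suc n) \<le> \<gamma> * (\<phi> * \<tau> n)"
    using \<tau>_Suc_le[of n] \<gamma> by (intro mult_left_mono) auto
  then have "\<beta> (Suc n) * (\<psi> + \<gamma> * \<tau> (Suc n)) \<le> \<beta> (Suc n) * (\<psi> + \<phi> * \<gamma> * \<tau> n)"
    using \<beta>_pos[of "Suc n"] by (intro mult_left_mono) (auto simp: algebra_simps)
  also have "\<dots> = \<beta> n * \<psi> * (1 + \<gamma> * \<tau> n)"
    unfolding \<beta>_Suc omega_of_def using D by (simp add: field_simps)
  finally show ?thesis .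
qed

lemma energy_decrease:
  "energy (Suc n) + 2 * (\<beta> (Suc n) * \<tau> (Suc n) * gap (Suc n)) + residual n \<le> energy n"
proof -
  define t b where "t = \<tau> (Suc n)" and "b = \<beta> (Suc n)"
  define \<delta> where "\<delta> = \<tau> (Suc n) / \<tau> n"
  define A1 A2 X1 R0 R1 Y0 Y1 where "A1 = (norm (z (Suc (Suc n)) - xs))\<^sup>2"
    and "A2 = (norm (z (Suc (Suc (Suc n))) - xs))\<^sup>2"
    and "X1 = (norm (x (Suc (Suc n)) - xs))\<^sup>2"
    and "R0 = (norm (x (Suc n) - z (Suc (Suc n))))\<^sup>2"
    and "R1 = (norm (x (Suc (Suc n)) - z (Suc (Suc n))))\<^sup>2"
    and "Y0 = (norm (y n - ys))\<^sup>2" and "Y1 = (norm (y (Suc n) - ys))\<^sup>2"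
  have pos: "0 < t" "0 < b" "0 < \<psi>" "0 < \<psi> - 1" "0 \<le> R1" "0 \<le> A2"
    using \<tau>_pos \<beta>_pos \<psi>_gt_1 by (auto simp: t_def b_def R1_def A2_def)
  have main: "2 * t * gap (Suc n) \<le> A1 - (1 + \<gamma> * t) * X1 + (\<psi> * \<delta> - 1) * R1 - \<psi> * \<delta> * R0 + (Y0 - Y1) / b"
    using gap_inequality[of n]
    unfolding t_def b_def \<delta>_def A1_def X1_def R0_def R1_def Y0_def Y1_def .
  have "A2 = (\<psi> - 1) / \<psi> * X1 + 1 / \<psi> * A1 - (\<psi> - 1) / \<psi> * (1 / \<psi>) * R1"
  proof -
    have one: "(\<psi> - 1) / \<psi> + 1 / \<psi> = 1" using pos by (simp add: field_simps)
    have "z (Suc (Suc (Suc n))) - xs = ((\<psi> - 1) / \<psi>) *\<^sub>R (x (Suc (Suc n)) - xs)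
        + (1 / \<psi>) *\<^sub>R (z (Suc (Suc n)) - xs)"
      unfolding z_Suc[of "Suc (Suc n)"] using one
      by (simp add: scaleR_diff_right algebra_simps flip: scaleR_add_left)
    then show ?thesis
      unfolding A1_def A2_def X1_def R1_def
      using norm_convex_combination[OF one, of "x (Suc (Suc n)) - xs" "z (Suc (Suc n)) - xs"] by simp
  qed
  \<comment> \<open>The convex combination identity solved for \<open>X1\<close>, with
    \<open>m\<close> in the role of \<open>\<psi> - 1\<close>.\<close>
  moreover have "X1 = \<psi> / m * (m / \<psi> * X1 + 1 / \<psi> * A1 - m / \<psi> * (1 / \<psi>) * R1) - 1 / m * A1 + R1 / \<psi>"
    if "0 < m" for m
    using pos that by (simp add: field_simps)
  ultimately have "X1 = \<psi> / (\<psi> - 1) * A2 - 1 / (\<psi> - 1) * A1 + R1 / \<psi>"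
    using pos(4) by simp
  then have "(1 + \<gamma> * t) * X1 = (1 + \<gamma> * t) * (\<psi> / (\<psi> - 1) * A2 - 1 / (\<psi> - 1) * A1 + R1 / \<psi>)"
    by (rule arg_cong)
  also have "\<dots> = (1 + \<gamma> * t) * (\<psi> / (\<psi> - 1) * A2) - (1 + \<gamma> * t) / (\<psi> - 1) * A1
      + (1 + \<gamma> * t) / \<psi> * R1"
    by (simp only: distrib_left right_diff_distrib) simp
  finally have X1: "(1 + \<gamma> * t) * X1 = (1 + \<gamma> * t) * (\<psi> / (\<psi> - 1) * A2)
      - (1 + \<gamma> * t) / (\<psi> - 1) * A1 + (1 + \<gamma> * t) / \<psi> * R1" .
  \<comment> \<open>This is where the value of \<phi> matters: \<psi> \<phi> = 1 + 1 / \<psi> is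
    exactly what the total coefficient of \<open>R1\<close> tolerates.\<close>
  have "\<psi> * \<delta> \<le> \<psi> * \<phi>"
    using \<tau>_Suc_le[of n] \<tau>_pos[of n] pos by (intro mult_left_mono) (auto simp: \<delta>_def divide_le_eq)
  also have "\<dots> \<le> 1 + (1 + \<gamma> * t) / \<psi>"
    unfolding \<psi>_times_\<phi> using pos \<gamma> by (simp add: divide_right_mono)
  finally have "(\<psi> * \<delta> - 1 - (1 + \<gamma> * t) / \<psi>) * R1 \<le> 0"
    using pos by (intro mult_nonpos_nonneg) auto
  then have "(\<psi> * \<delta> - 1) * R1 \<le> (1 + \<gamma> * t) / \<psi> * R1" by (simp add: algebra_simps)
  with main X1 have "2 * t * gap (Suc n) \<le> A1 - (1 + \<gamma> * t) * (\<psi> / (\<psi> - 1) * A2)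
      + (1 + \<gamma> * t) / (\<psi> - 1) * A1 - \<psi> * \<delta> * R0 + (Y0 - Y1) / b"
    by linarith
  moreover have "A1 + (1 + \<gamma> * t) / (\<psi> - 1) * A1 = (\<psi> + \<gamma> * t) / (\<psi> - 1) * A1"
    using pos by (simp add: field_simps)
  ultimately have "2 * t * gap (Suc n) \<le> (\<psi> + \<gamma> * t) / (\<psi> - 1) * A1
      - (1 + \<gamma> * t) * (\<psi> / (\<psi> - 1) * A2) - \<psi> * \<delta> * R0 + (Y0 - Y1) / b"
    by linarith
  then have "b * (2 * t * gap (Suc n)) \<le> b * ((\<psi> + \<gamma> * t) / (\<psi> - 1) * A1
      - (1 + \<gamma> * t) * (\<psi> / (\<psi> - 1) * A2) - \<psi> * \<delta> * R0 + (Y0 - Y1) / b)"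
    using pos by (intro mult_left_mono) auto
  also have "\<dots> = b * (\<psi> + \<gamma> * t) / (\<psi> - 1) * A1 - b * \<psi> * (1 + \<gamma> * t) / (\<psi> - 1) * A2
      - b * \<psi> * \<delta> * R0 + Y0 - Y1"
    using pos
    by (simp add: distrib_left right_diff_distrib) (simp add: algebra_simps, simp add: diff_divide_distrib)
  finally have "b * \<psi> * (1 + \<gamma> * t) / (\<psi> - 1) * A2 + Y1 + 2 * (b * t * gap (Suc n)) + b * \<psi> * \<delta> * R0
      \<le> b * (\<psi> + \<gamma> * t) / (\<psi> - 1) * A1 + Y0"
    by (simp add: mult.assoc mult.left_commute)
  moreover have "\<beta> (Suc (Suc n)) * (\<psi> + \<gamma> * \<tau> (Suc (Suc n))) / (\<psi> - 1) * A2
      \<le> b * \<psi> * (1 + \<gamma> * t) / (\<psi> - 1) * A2"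
    using weight_decrease[of "Suc n"] pos unfolding t_def b_def
    by (intro mult_right_mono divide_right_mono) auto
  ultimately show ?thesis
    unfolding energy_def residual_def t_def b_def \<delta>_def A1_def A2_def R0_def Y0_def Y1_def by linarith
qed

lemma energy_nonneg: "0 \<le> energy n"
  unfolding energy_def using \<beta>_pos[of "Suc n"] \<tau>_pos[of "Suc n"] \<gamma> \<psi>_gt_1 by simp

lemma sum_energy:
  "energy n + (\<Sum>k<n. 2 * (\<beta> (Suc k) * \<tau> (Suc k) * gap (Suc k)) + residual k) \<le> energy 0"
proof (induction n)
  case (Suc n)
  then show ?case using energy_decrease[of n] by simp
qed simp

lemma weighted_gap_nonneg: "0 \<le> \<beta> (Suc k) * \<tau> (Suc k) * gap (Suc k)"
  using gap_nonneg[of k] \<beta>_pos[of "Suc k"] \<tau>_pos[of "Suc k"] by simp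

lemma energy_le: "energy n \<le> energy 0"
proof -
  have "0 \<le> (\<Sum>k<n. 2 * (\<beta> (Suc k) * \<tau> (Suc k) * gap (Suc k)) + residual k)"
    using weighted_gap_nonneg residual_nonneg by (intro sum_nonneg) (simp add: add_nonneg_nonneg)
  then show ?thesis using sum_energy[of n] by linarith
qed

lemma sum_weighted_gap_le: "(\<Sum>k<n. \<beta> (Suc k) * \<tau> (Suc k) * gap (Suc k)) \<le> energy 0"
proof -
  have "(\<Sum>k<n. \<beta> (Suc k) * \<tau> (Suc k) * gap (Suc k))
      \<le> (\<Sum>k<n. 2 * (\<beta> (Suc k) * \<tau> (Suc k) * gap (Suc k)) + residual k)"
  proof (rule sum_mono)
    fix k
    show "\<beta> (Suc k) * \<tau> (Suc k) * gap (Suc k)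
        \<le> 2 * (\<beta> (Suc k) * \<tau> (Suc k) * gap (Suc k)) + residual k"
      using weighted_gap_nonneg[of k] residual_nonneg[of k] by linarith
  qed
  then show ?thesis using sum_energy[of n] energy_nonneg[of n] by linarith
qed

lemma residual_tendsto_0: "residual \<longlonglongrightarrow> 0"
proof (rule summable_LIMSEQ_zero, rule summableI_nonneg_bounded)
  fix n
  have "(\<Sum>k<n. residual k) \<le> (\<Sum>k<n. 2 * (\<beta> (Suc k) * \<tau> (Suc k) * gap (Suc k)) + residual k)"
    using weighted_gap_nonneg by (intro sum_mono) simp
  then show "(\<Sum>k<n. residual k) \<le> energy 0"
    using sum_energy[of n] energy_nonneg[of n] by linarith
qed (rule residual_nonneg)

section \<open>Boundedness of the dual iterates, rates for the primal ones, cluster points\<close>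

lemma norm_y_le: "norm (y n - ys) \<le> sqrt (energy 0)"
proof (rule real_le_rsqrt)
  have "(norm (y n - ys))\<^sup>2 \<le> energy n"
    unfolding energy_def using \<beta>_pos[of "Suc n"] \<tau>_pos[of "Suc n"] \<gamma> \<psi>_gt_1 by simp
  then show "(norm (y n - ys))\<^sup>2 \<le> energy 0" using energy_le[of n] by linarith
qed

lemma z_rate: "\<exists>C>0. \<forall>n\<ge>1. norm (z (Suc n) - xs) \<le> C / real n"
proof -
  obtain c where "step_sizes \<gamma> \<psi> \<phi> c \<beta> \<tau>" by (rule step_sizes)
  then interpret step_sizes \<gamma> \<psi> \<phi> c \<beta> \<tau> .
  obtain d where d: "d > 0" "\<And>n. d * (real n)\<^sup>2 \<le> \<beta> n" using \<beta>_quadratic_growth by blast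
  define C where "C = sqrt (energy 0 / d) + 1"
  have "0 < C" using energy_nonneg[of 0] d(1) by (simp add: C_def add_nonneg_pos)
  moreover have "norm (z (Suc n) - xs) \<le> C / real n" if n: "n \<ge> 1" for n
  proof -
    obtain m where m: "n = Suc m" using n by (cases n) auto
    have "0 < \<gamma> * \<tau> n" using \<gamma> \<tau>_pos[of n] by simp
    then have "1 \<le> (\<psi> + \<gamma> * \<tau> n) / (\<psi> - 1)"
      using \<psi>_gt_1 by (simp add: le_divide_eq)
    then have "\<beta> n * 1 \<le> \<beta> n * ((\<psi> + \<gamma> * \<tau> n) / (\<psi> - 1))"
      using \<beta>_pos[of n] by (intro mult_left_mono) auto
    then have "\<beta> n * (norm (z (Suc n) - xs))\<^sup>2
        \<le> \<beta> n * (\<psi> + \<gamma> * \<tau> n) / (\<psi> - 1) * (norm (z (Suc n) - xs))\<^sup>2"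
      by (intro mult_right_mono) auto
    also have "\<dots> \<le> energy m" by (simp add: energy_def m)
    also have "\<dots> \<le> energy 0" by (rule energy_le)
    finally have "\<beta> n * (norm (z (Suc n) - xs))\<^sup>2 \<le> energy 0" .
    moreover have "d * (real n)\<^sup>2 * (norm (z (Suc n) - xs))\<^sup>2 \<le> \<beta> n * (norm (z (Suc n) - xs))\<^sup>2"
      using d(2)[of n] by (intro mult_right_mono) auto
    ultimately have "d * (real n)\<^sup>2 * (norm (z (Suc n) - xs))\<^sup>2 \<le> energy 0" by linarith
    then have "(real n * norm (z (Suc n) - xs))\<^sup>2 \<le> energy 0 / d"
      using d(1) by (simp add: le_divide_eq power_mult_distrib algebra_simps)
    then have "real n * norm (z (Suc n) - xs) \<le> sqrt (energy 0 / d)" by (rule real_le_rsqrt)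
    then have "real n * norm (z (Suc n) - xs) \<le> C" by (simp add: C_def)
    then show ?thesis using n by (simp add: le_divide_eq mult.commute)
  qed
  ultimately show ?thesis by blast
qed

text \<open>The energy sees only \<open>z\<close>; solving the averaging step for
  \<open>x (Suc n)\<close> expresses its error through the errors of two consecutive points
  \<open>z\<close>.\<close>

lemma x_rate: "\<exists>C>0. \<forall>n\<ge>1. norm (x (Suc n) - xs) \<le> C / real n"
proof -
  obtain C where C: "C > 0" "\<And>n. n \<ge> 1 \<Longrightarrow> norm (z (Suc n) - xs) \<le> C / real n"
    using z_rate by blast
  define C' where "C' = (\<psi> + 1) / (\<psi> - 1) * C"
  have "0 < C'" using C \<psi>_gt_1 by (simp add: C'_def)
  moreover have "norm (x (Suc n) - xs) \<le> C' / real n" if n: "n \<ge> 1" for n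
  proof -
    have "(\<psi> - 1) *\<^sub>R (x (Suc n) - xs) = \<psi> *\<^sub>R (z (Suc (Suc n)) - xs) - (z (Suc n) - xs)"
      unfolding z_Suc[of "Suc n"] using \<psi>_gt_1
      by (simp add: scaleR_diff_right scaleR_add_right scaleR_diff_left)
    then have "norm ((\<psi> - 1) *\<^sub>R (x (Suc n) - xs)) = norm (\<psi> *\<^sub>R (z (Suc (Suc n)) - xs) - (z (Suc n) - xs))"
      by simp
    then have "(\<psi> - 1) * norm (x (Suc n) - xs) = norm (\<psi> *\<^sub>R (z (Suc (Suc n)) - xs) - (z (Suc n) - xs))"
      using \<psi>_gt_1 by simp
    also have "\<dots> \<le> norm (\<psi> *\<^sub>R (z (Suc (Suc n)) - xs)) + norm (z (Suc n) - xs)"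
      by (rule norm_triangle_ineq4)
    also have "\<dots> = \<psi> * norm (z (Suc (Suc n)) - xs) + norm (z (Suc n) - xs)"
      using \<psi>_gt_1 by simp
    also have "\<dots> \<le> \<psi> * (C / real n) + C / real n"
    proof (intro add_mono mult_left_mono)
      have "C / real (Suc n) \<le> C / real n" using C n by (intro divide_left_mono) auto
      then show "norm (z (Suc (Suc n)) - xs) \<le> C / real n" using C(2)[of "Suc n"] by simp
    qed (use C n \<psi>_gt_1 in auto)
    also have "\<dots> = (\<psi> + 1) * (C / real n)" by (simp only: distrib_right mult_1_left)
    finally have "(\<psi> - 1) * norm (x (Suc n) - xs) / (\<psi> - 1) \<le> (\<psi> + 1) * (C / real n) / (\<psi> - 1)"
      using \<psi>_gt_1 by (intro divide_right_mono) auto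
    then have "norm (x (Suc n) - xs) \<le> (\<psi> + 1) * (C / real n) / (\<psi> - 1)"
      using \<psi>_gt_1 by simp
    then show ?thesis by (simp add: C'_def mult.commute)
  qed
  ultimately show ?thesis by blast
qed

lemma x_tendsto: "x \<longlonglongrightarrow> xs"
proof -
  obtain C where C: "C > 0" "\<And>n. n \<ge> 1 \<Longrightarrow> norm (x (Suc n) - xs) \<le> C / real n"
    using x_rate by blast
  have "(\<lambda>n. C / real n) \<longlonglongrightarrow> 0" by (rule lim_const_over_n)
  moreover have "\<forall>\<^sub>F n in sequentially. norm (x (Suc n) - xs) \<le> C / real n"
    using eventually_ge_at_top[of 1] by eventually_elim (rule C(2))
  ultimately have "(\<lambda>n. x (Suc n) - xs) \<longlonglongrightarrow> 0" by (rule Lim_null_comparison[rotated])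
  then have "(\<lambda>n. x (Suc n)) \<longlonglongrightarrow> xs" by (simp add: LIM_zero_iff)
  then show ?thesis by (simp add: filterlim_sequentially_Suc)
qed

lemma bounded_y: "bounded (range y)"
proof (rule bounded_subset)
  show "bounded (cball ys (sqrt (energy 0)))" by (rule bounded_cball)
  show "range y \<subseteq> cball ys (sqrt (energy 0))"
    using norm_y_le by (auto simp: dist_norm norm_minus_commute)
qed

text \<open>The pair \<open>(x (n + 1), y n)\<close> has subgradients that differ from the optimality conditions by
  \<open>(z (n + 1) - x (n + 1)) / \<tau> n\<close> and \<open>(y (n - 1) - y n) / (\<beta> n * \<tau> n)\<close>. Both vanish along the
  indices where the step sizes at \<open>n\<close> and \<open>n + 1\<close> are of the order \<open>1 / sqrt \<beta>\<close>.\<close>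
lemma cluster_point:
  obtains yc r where "strict_mono (r :: nat \<Rightarrow> nat)" "\<And>k. 1 \<le> r k" "(\<lambda>k. y (r k)) \<longlonglongrightarrow> yc"
    "(xs, yc) \<in> saddle_solutions g f K"
proof -
  obtain c where "step_sizes \<gamma> \<psi> \<phi> c \<beta> \<tau>" by (rule step_sizes)
  then interpret step_sizes \<gamma> \<psi> \<phi> c \<beta> \<tau> .
  obtain \<sigma> where \<sigma>: "\<sigma> > 0" "\<And>N. \<exists>n\<ge>N. \<sigma> \<le> s n \<and> \<sigma> \<le> s (Suc n)"
    using frequently_large_pair by blast
  obtain d where d: "d > 0" "\<And>n. d * real n \<le> u n" using u_linear_growth by blast
  \<comment> \<open>The shift by one leaves a predecessor \<open>y n\<close> for the dual point
    \<open>y (Suc n)\<close> of the subsequence.\<close>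
  define I where "I = {n. \<sigma> \<le> s (Suc n) \<and> \<sigma> \<le> s (Suc (Suc n))}"
  have "infinite I"
    unfolding infinite_nat_iff_unbounded_le
  proof
    fix N
    obtain n where "n \<ge> Suc N" "\<sigma> \<le> s n \<and> \<sigma> \<le> s (Suc n)" using \<sigma>(2) by blast
    then have "n - 1 \<ge> N \<and> n - 1 \<in> I" by (auto simp: I_def)
    then show "\<exists>n\<ge>N. n \<in> I" by blast
  qed
  then obtain r1 :: "nat \<Rightarrow> nat" where r1: "strict_mono r1" "\<And>k. r1 k \<in> I"
    using infinite_enumerate by blast
  have "bounded (range (\<lambda>k. y (Suc (r1 k))))"
    by (rule bounded_subset[OF bounded_y]) auto
  then obtain yc r2 where r2: "strict_mono (r2 :: nat \<Rightarrow> nat)" "((\<lambda>k. y (Suc (r1 k))) \<circ> r2) \<longlonglongrightarrow> yc"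
    using bounded_imp_convergent_subsequence[of "\<lambda>k. y (Suc (r1 k))"] by blast
  define r where "r = r1 \<circ> r2"
  have r: "strict_mono r" "\<And>k. r k \<in> I"
    using r1 r2 by (auto simp: r_def strict_mono_o)
  have lim_y: "(\<lambda>k. y (Suc (r k))) \<longlonglongrightarrow> yc" using r2(2) by (simp add: r_def o_def)
  have r_top: "filterlim r at_top sequentially" using r(1) by (rule filterlim_subseq)
  have lim_x: "(\<lambda>k. x (Suc (r k))) \<longlonglongrightarrow> xs" "(\<lambda>k. x (Suc (Suc (r k)))) \<longlonglongrightarrow> xs"
    using LIMSEQ_subseq_LIMSEQ[OF LIMSEQ_Suc[OF x_tendsto] r(1)]
      LIMSEQ_subseq_LIMSEQ[OF LIMSEQ_Suc[OF LIMSEQ_Suc[OF x_tendsto]] r(1)]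
    by (simp_all add: o_def)
  have "(\<lambda>k. (1 / \<tau> (Suc (r k))) *\<^sub>R (z (Suc (Suc (r k))) - x (Suc (Suc (r k))))) \<longlonglongrightarrow> 0" (is "?e \<longlonglongrightarrow> 0")
  proof -
    \<comment> \<open>In terms of \<open>?e\<close> the residual carries the factor \<beta> (n + 1)
      \<tau> (n + 1) \<tau> n / \<psi>. Two consecutive large values of \<open>s\<close> are
      required to keep it above \<sigma>^2 / \<psi>.\<close>
    have bound: "(norm (?e k))\<^sup>2 \<le> \<psi> / \<sigma>\<^sup>2 * residual (Suc (r k))" for k
    proof -
      define n where "n = Suc (r k)"
      have large: "\<sigma> \<le> s n" "\<sigma> \<le> s (Suc n)" using r(2)[of k] by (auto simp: I_def n_def)
      have xz: "x (Suc n) - z (Suc (Suc n)) = (1 / \<psi>) *\<^sub>R (x (Suc n) - z (Suc n))"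
        unfolding z_Suc[of "Suc n"] using \<psi>_gt_1
        by (simp add: diff_divide_distrib scaleR_diff_left scaleR_diff_right)
      have e: "?e k = (1 / \<tau> n) *\<^sub>R (z (Suc n) - x (Suc n))" by (simp add: n_def)
      have "residual n = \<beta> (Suc n) * \<tau> (Suc n) * \<tau> n / \<psi> * (norm (?e k))\<^sup>2"
        unfolding residual_def xz e using \<tau>_pos[of n] \<psi>_gt_1
        by (simp add: norm_minus_commute power_mult_distrib power_divide power2_eq_square)
      moreover have "\<sigma>\<^sup>2 \<le> \<beta> (Suc n) * \<tau> (Suc n) * \<tau> n"
      proof -
        have "\<sigma> * \<sigma> \<le> s (Suc n) * s n" using large \<sigma>(1) by (intro mult_mono) auto
        also have "\<dots> \<le> s (Suc n) * (\<tau> n * u (Suc n))"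
          unfolding s_def[of n] using u_mono[of n] \<tau>_pos[of n] s_pos[of "Suc n"]
          by (intro mult_left_mono) auto
        also have "\<dots> = \<beta> (Suc n) * \<tau> (Suc n) * \<tau> n"
          by (simp add: s_def flip: u_squared)
        finally show ?thesis by (simp add: power2_eq_square)
      qed
      then have "\<sigma>\<^sup>2 / \<psi> * (norm (?e k))\<^sup>2 \<le> \<beta> (Suc n) * \<tau> (Suc n) * \<tau> n / \<psi> * (norm (?e k))\<^sup>2"
        using \<psi>_gt_1 by (intro mult_right_mono divide_right_mono) auto
      ultimately have "\<sigma>\<^sup>2 / \<psi> * (norm (?e k))\<^sup>2 \<le> residual n" by simp
      then have "\<psi> / \<sigma>\<^sup>2 * (\<sigma>\<^sup>2 / \<psi> * (norm (?e k))\<^sup>2) \<le> \<psi> / \<sigma>\<^sup>2 * residual n"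
        using \<psi>_gt_1 by (intro mult_left_mono) auto
      then show ?thesis using \<psi>_gt_1 \<sigma>(1) by (simp add: n_def)
    qed
    have lim: "(\<lambda>k. \<psi> / \<sigma>\<^sup>2 * residual (Suc (r k))) \<longlonglongrightarrow> 0"
      using LIMSEQ_subseq_LIMSEQ[OF LIMSEQ_Suc[OF residual_tendsto_0] r(1)]
      by (intro tendsto_mult_right_zero) (simp add: o_def)
    have "(\<lambda>k. (norm (?e k))\<^sup>2) \<longlonglongrightarrow> 0"
      by (rule Lim_null_comparison[OF always_eventually lim]) (use bound in simp)
    then have "(\<lambda>k. sqrt ((norm (?e k))\<^sup>2)) \<longlonglongrightarrow> sqrt 0" by (rule tendsto_real_sqrt)
    then show ?thesis by (simp only: real_sqrt_abs abs_norm_cancel real_sqrt_zero tendsto_norm_zero_iff)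
  qed
  moreover have "(\<lambda>k. adjoint K (y (Suc (r k)))) \<longlonglongrightarrow> adjoint K yc"
    using adjoint_linear[OF K] lim_y by (rule linear_tendsto)
  ultimately have "(\<lambda>k. ?e k - adjoint K (y (Suc (r k)))) \<longlonglongrightarrow> 0 - adjoint K yc"
    by (rule tendsto_diff)
  then have g_yc: "0 - adjoint K yc \<in> subdifferential g xs"
    by (rule subdifferential_closed_graph[OF g x_subgradient lim_x(2)])
  have "(\<lambda>k. (1 / (\<beta> (Suc (r k)) * \<tau> (Suc (r k)))) *\<^sub>R (y (r k) - y (Suc (r k)))) \<longlonglongrightarrow> 0" (is "?e \<longlonglongrightarrow> 0")
  proof -
    define C where "C = 2 * sqrt (energy 0) / (\<sigma> * d)"
    \<comment> \<open>The dual increments are merely known to be bounded; the quotient vanishes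
      because \<beta> n \<tau> n = s n u n is at least \<sigma> d n on these indices.\<close>
    have bound: "norm (?e k) \<le> C * inverse (real (Suc (r k)))" for k
    proof -
      define n where "n = Suc (r k)"
      have n: "1 \<le> n" and large: "\<sigma> \<le> s n" using r(2)[of k] by (auto simp: I_def n_def)
      have "\<sigma> * (d * real n) \<le> s n * u n"
        using large d \<sigma>(1) s_pos[of n] by (intro mult_mono) auto
      also have "\<dots> = \<beta> n * \<tau> n" by (simp add: s_def flip: u_squared)
      finally have low: "\<sigma> * d * real n \<le> \<beta> n * \<tau> n" by simp
      have "norm (y (r k) - y n) = norm ((y (r k) - ys) - (y n - ys))" by simp
      also have "\<dots> \<le> norm (y (r k) - ys) + norm (y n - ys)" by (rule norm_triangle_ineq4)
      also have "\<dots> \<le> 2 * sqrt (energy 0)" using norm_y_le[of "r k"] norm_y_le[of n] by simp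
      finally have "norm (y (r k) - y n) \<le> 2 * sqrt (energy 0)" .
      then have "norm (y (r k) - y n) / (\<beta> n * \<tau> n) \<le> 2 * sqrt (energy 0) / (\<sigma> * d * real n)"
        using low n \<sigma>(1) d(1) energy_nonneg[of 0] by (intro frac_le) auto
      moreover have "norm (?e k) = norm (y (r k) - y n) / (\<beta> n * \<tau> n)"
        using \<beta>_pos[of n] \<tau>_pos[of n] by (simp add: n_def)
      moreover have "2 * sqrt (energy 0) / (\<sigma> * d * real n) = C * inverse (real (Suc (r k)))"
        by (simp add: n_def C_def divide_inverse)
      ultimately show ?thesis by simp
    qed
    have lim: "(\<lambda>k. C * inverse (real (Suc (r k)))) \<longlonglongrightarrow> 0"
      using LIMSEQ_subseq_LIMSEQ[OF LIMSEQ_inverse_real_of_nat r(1)]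
      by (intro tendsto_mult_right_zero) (simp add: o_def)
    show ?thesis using bound by (intro Lim_null_comparison[OF always_eventually lim] allI)
  qed
  moreover have "(\<lambda>k. K (x (Suc (r k)))) \<longlonglongrightarrow> K xs"
    using K lim_x(1) by (rule linear_tendsto)
  ultimately have "(\<lambda>k. ?e k + K (x (Suc (r k)))) \<longlonglongrightarrow> 0 + K xs"
    by (intro tendsto_add)
  then have "0 + K xs \<in> subdifferential (fenchel_conjugate f) yc"
    by (rule subdifferential_closed_graph[OF f' y_subgradient lim_y])
  with g_yc have "(xs, yc) \<in> saddle_solutions g f K" by (simp add: saddle_solutions_iff)
  moreover have "strict_mono (\<lambda>k. Suc (r k))" using r(1) by (simp add: strict_mono_def)
  ultimately show thesis using that[of "\<lambda>k. Suc (r k)" yc] lim_y by simp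
qed

text \<open>For a fixed saddle point the gap is a convex function of \<open>x\<close> plus a convex
  function of \<open>y\<close>. Jensen's inequality bounds it at the averages by the weighted mean
  of the gaps, whose sum the energy controls.\<close>

lemma ergodic_gap_le:
  fixes N :: nat
  assumes N: "1 \<le> N"
  defines "S \<equiv> \<Sum>n=1..N. \<beta> n * \<tau> n"
  shows "pd_gap g f K xs ys ((1 / S) *\<^sub>R (\<Sum>n=1..N. (\<beta> n * \<tau> n) *\<^sub>R x n))
    ((1 / S) *\<^sub>R (\<Sum>n=1..N. (\<beta> n * \<tau> n) *\<^sub>R y n)) \<le> ereal (energy 0 / S)"
proof -
  define w where "w = (\<lambda>n. \<beta> n * \<tau> n / S)"
  have S: "0 < S" unfolding S_def using N \<beta>_pos \<tau>_pos by (intro sum_pos) auto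
  have w: "\<And>n. 0 \<le> w n" "sum w {1..N} = 1"
    using S \<beta>_pos \<tau>_pos by (auto simp: w_def S_def less_imp_le simp flip: sum_divide_distrib)
  define X Y where "X = (\<Sum>n=1..N. w n *\<^sub>R x n)" and "Y = (\<Sum>n=1..N. w n *\<^sub>R y n)"
  have XY: "(1 / S) *\<^sub>R (\<Sum>n=1..N. (\<beta> n * \<tau> n) *\<^sub>R x n) = X" "(1 / S) *\<^sub>R (\<Sum>n=1..N. (\<beta> n * \<tau> n) *\<^sub>R y n) = Y"
    by (simp_all add: X_def Y_def w_def scaleR_sum_right)
  have vals: "g (x n) = ereal (gx n)" "fenchel_conjugate f (y n) = ereal (fy n)" if "n \<in> {1..N}" for n
    using that g_x[of "n - 1"] f_y[of "n - 1"] by auto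
  obtain gX where gX: "g X = ereal gX" "gX \<le> (\<Sum>n=1..N. w n * gx n)"
    unfolding X_def by (rule epigraph_Jensen[OF g, of "{1..N}" w x gx]) (use w vals in auto)
  obtain fY where fY: "fenchel_conjugate f Y = ereal fY" "fY \<le> (\<Sum>n=1..N. w n * fy n)"
    unfolding Y_def by (rule epigraph_Jensen[OF f', of "{1..N}" w y fy]) (use w vals in auto)
  have sums: "(\<Sum>n=1..N. w n * (p \<bullet> x n)) = p \<bullet> X" "(\<Sum>n=1..N. w n * (q \<bullet> y n)) = q \<bullet> Y"
    "(\<Sum>n=1..N. w n * c) = c" for p q c
    using w(2) by (simp_all add: X_def Y_def inner_sum_right flip: sum_distrib_right)
  have "pd_gap g f K xs ys X Y = ereal (gX + K X \<bullet> ys - fys - (gxs + K xs \<bullet> Y - fY))"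
    by (simp add: pd_gap_def lagrangian_def gX fY g_xs f_ys)
  also have "\<dots> \<le> ereal (\<Sum>n=1..N. w n * gap n)"
  proof -
    have "(\<Sum>n=1..N. w n * gap n) = (\<Sum>n=1..N. w n * gx n + w n * (adjoint K ys \<bullet> x n) + w n * fy n
        - w n * (K xs \<bullet> y n) + w n * (K xs \<bullet> ys - adjoint K ys \<bullet> xs - gxs - fys))"
      by (simp add: gap_def algebra_simps inner_diff_right)
    also have "\<dots> = (\<Sum>n=1..N. w n * gx n) + adjoint K ys \<bullet> X + (\<Sum>n=1..N. w n * fy n)
        - K xs \<bullet> Y + (K xs \<bullet> ys - adjoint K ys \<bullet> xs - gxs - fys)"
      by (simp only: sum.distrib sum_subtractf sums)
    finally show ?thesis using gX(2) fY(2) by (simp add: adjoint_inner)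
  qed
  also have "(\<Sum>n=1..N. w n * gap n) = (\<Sum>n=1..N. \<beta> n * \<tau> n * gap n) / S"
    by (simp add: w_def sum_divide_distrib)
  also have "(\<Sum>n=1..N. \<beta> n * \<tau> n * gap n) = (\<Sum>k<N. \<beta> (Suc k) * \<tau> (Suc k) * gap (Suc k))"
    by (rule sum.reindex_bij_witness[of _ Suc "\<lambda>n. n - 1"]) auto
  also have "ereal (\<dots> / S) \<le> ereal (energy 0 / S)"
    using sum_weighted_gap_le[of N] S by (simp add: divide_right_mono)
  finally show ?thesis unfolding XY .
qed

lemma ergodic_gap_rate:
  "\<exists>C>0. \<forall>N\<ge>1. let S = (\<Sum>n=1..N. \<beta> n * \<tau> n);
      X = (1 / S) *\<^sub>R (\<Sum>n=1..N. (\<beta> n * \<tau> n) *\<^sub>R x n);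
      Y = (1 / S) *\<^sub>R (\<Sum>n=1..N. (\<beta> n * \<tau> n) *\<^sub>R y n)
    in pd_gap g f K xs ys X Y \<le> ereal (C / (real N)\<^sup>2)"
proof -
  obtain c where "step_sizes \<gamma> \<psi> \<phi> c \<beta> \<tau>" by (rule step_sizes)
  then interpret step_sizes \<gamma> \<psi> \<phi> c \<beta> \<tau> .
  obtain d where d: "d > 0" "\<And>N. N \<ge> 1 \<Longrightarrow> d * (real N)\<^sup>2 \<le> (\<Sum>n=1..N. \<beta> n * \<tau> n)"
    using sum_weights_quadratic_growth by blast
  define C where "C = energy 0 / d + 1"
  have "0 < C" using energy_nonneg[of 0] d(1) by (simp add: C_def add_nonneg_pos)
  moreover have "energy 0 / (\<Sum>n=1..N. \<beta> n * \<tau> n) \<le> C / (real N)\<^sup>2" if "N \<ge> 1" for N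
  proof -
    have "energy 0 / (\<Sum>n=1..N. \<beta> n * \<tau> n) \<le> energy 0 / (d * (real N)\<^sup>2)"
      using d(1) d(2)[OF that] that energy_nonneg[of 0] by (intro frac_le) auto
    also have "\<dots> \<le> C / (real N)\<^sup>2"
      using that by (simp add: C_def add_divide_distrib)
    finally show ?thesis .
  qed
  ultimately show ?thesis
    unfolding Let_def
    by (intro exI[of _ C] conjI allI impI order_trans[OF ergodic_gap_le]) (simp_all only: ereal_less_eq(3))
qed

end

theorem theorem4p1:
  fixes g :: "'q::euclidean_space \<Rightarrow> ereal"
    and f :: "'p::euclidean_space \<Rightarrow> ereal"
    and K :: "'q \<Rightarrow> 'p"
    and \<gamma>g \<psi> \<mu> :: real
    and z x :: "nat \<Rightarrow> 'q"
    and y :: "nat \<Rightarrow> 'p"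
    and \<beta> \<tau> :: "nat \<Rightarrow> real"
  assumes "closed_proper_convex f"
    and "closed_proper_convex g"
    and "linear K"
    and "primal_solutions g f K \<noteq> {}"
    and "\<exists>xt \<in> rel_interior (effective_domain g). K xt \<in> rel_interior (effective_domain f)"
    and "\<gamma>g > 0"
    and "strongly_convex \<gamma>g g"
    and "psi0 < \<psi>" and "\<psi> < golden_ratio"
    and "0 < \<mu>" and "\<mu> < 1"
    and "\<beta> 0 > 0" and "\<tau> 0 > 0"
    and "agrpda_linesearch g f K \<gamma>g \<psi> \<mu> z x y \<beta> \<tau>"
  shows "\<exists>xs. primal_solutions g f K = {xs} \<and>
      (\<forall>(xb, yb) \<in> saddle_solutions g f K. xb = xs) \<and>
      (\<exists>C1>0. \<exists>C2>0. \<forall>n\<ge>1.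
         norm (z (n + 1) - xs) \<le> C1 / real n \<and> norm (x (n + 1) - xs) \<le> C2 / real n) \<and>
      (bounded (y ` {1..}) \<and>
       (\<exists>ys r. strict_mono (r :: nat \<Rightarrow> nat) \<and> (\<forall>k. r k \<ge> 1) \<and> (\<lambda>k. y (r k)) \<longlonglongrightarrow> ys \<and>
          (xs, ys) \<in> saddle_solutions g f K)) \<and>
      (\<forall>(xb, yb) \<in> saddle_solutions g f K. \<exists>C3>0. \<forall>N\<ge>1.
         let S = (\<Sum>n=1..N. \<beta> n * \<tau> n);
             X = (1 / S) *\<^sub>R (\<Sum>n=1..N. (\<beta> n * \<tau> n) *\<^sub>R x n);
             Y = (1 / S) *\<^sub>R (\<Sum>n=1..N. (\<beta> n * \<tau> n) *\<^sub>R y n)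
         in pd_gap g f K xb yb X Y \<le> ereal (C3 / (real N)\<^sup>2))"
proof -
  note f = assms(1) and g = assms(2) and K = assms(3) and sc = assms(6,7)
  obtain xs where xs: "xs \<in> primal_solutions g f K" using assms(4) by blast
  obtain xt where "xt \<in> rel_interior (effective_domain g)" "K xt \<in> rel_interior (effective_domain f)"
    using assms(5) by blast
  from Fenchel_Rockafellar_multiplier[OF f g K this xs]
  obtain ys where ys: "ys \<in> subdifferential f (K xs)" "- adjoint K ys \<in> subdifferential g xs" .
  note f' = conjugate_subgradient[OF f ys(1)]
  have saddle: "(xs, ys) \<in> saddle_solutions g f K"
    using ys(2) f'(2) by (simp add: saddle_solutions_iff)
  \<comment> \<open>Needed for every saddle point: the constant in the gap bound is built from the
    initial energy measured from \<open>(xb, yb)\<close>.\<close>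
  have inst: "accelerated_grpda g f K \<gamma>g \<psi> \<mu> z x y \<beta> \<tau> xb yb"
    if "(xb, yb) \<in> saddle_solutions g f K" for xb yb
    using assms f'(1) that by (intro accelerated_grpda.intro)
  interpret accelerated_grpda g f K \<gamma>g \<psi> \<mu> z x y \<beta> \<tau> xs ys
    by (rule inst[OF saddle])
  obtain C1 where C1: "C1 > 0" "\<forall>n\<ge>1. norm (z (Suc n) - xs) \<le> C1 / real n"
    using z_rate by blast
  obtain C2 where C2: "C2 > 0" "\<forall>n\<ge>1. norm (x (Suc n) - xs) \<le> C2 / real n"
    using x_rate by blast
  obtain yc r where r: "strict_mono (r :: nat \<Rightarrow> nat)" "\<And>k. 1 \<le> r k" "(\<lambda>k. y (r k)) \<longlonglongrightarrow> yc"
      "(xs, yc) \<in> saddle_solutions g f K"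
    using cluster_point by metis
  show ?thesis
  proof (intro exI[of _ xs] conjI)
    show "primal_solutions g f K = {xs}"
      by (rule primal_solution_unique[OF f g K sc xs ys])
    show "\<forall>(xb, yb) \<in> saddle_solutions g f K. xb = xs"
      using saddle_solution_primal_unique[OF f'(1) g K sc _ saddle] by blast
    show "\<exists>C1>0. \<exists>C2>0. \<forall>n\<ge>1.
        norm (z (n + 1) - xs) \<le> C1 / real n \<and> norm (x (n + 1) - xs) \<le> C2 / real n"
      unfolding Suc_eq_plus1[symmetric] using C1 C2 by blast
    show "bounded (y ` {1..})"
      by (rule bounded_subset[OF bounded_y]) auto
    show "\<exists>ys r. strict_mono (r :: nat \<Rightarrow> nat) \<and> (\<forall>k. r k \<ge> 1) \<and> (\<lambda>k. y (r k)) \<longlonglongrightarrow> ys \<and>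
        (xs, ys) \<in> saddle_solutions g f K"
      using r by blast
    show "\<forall>(xb, yb) \<in> saddle_solutions g f K. \<exists>C3>0. \<forall>N\<ge>1.
         let S = (\<Sum>n=1..N. \<beta> n * \<tau> n);
             X = (1 / S) *\<^sub>R (\<Sum>n=1..N. (\<beta> n * \<tau> n) *\<^sub>R x n);
             Y = (1 / S) *\<^sub>R (\<Sum>n=1..N. (\<beta> n * \<tau> n) *\<^sub>R y n)
         in pd_gap g f K xb yb X Y \<le> ereal (C3 / (real N)\<^sup>2)"
    proof (intro ballI, clarify)
      fix xb yb
      assume "(xb, yb) \<in> saddle_solutions g f K"
      from accelerated_grpda.ergodic_gap_rate[OF inst[OF this]]
      show "\<exists>C3>0. \<forall>N\<ge>1.
         let S = (\<Sum>n=1..N. \<beta> n * \<tau> n);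
             X = (1 / S) *\<^sub>R (\<Sum>n=1..N. (\<beta> n * \<tau> n) *\<^sub>R x n);
             Y = (1 / S) *\<^sub>R (\<Sum>n=1..N. (\<beta> n * \<tau> n) *\<^sub>R y n)
         in pd_gap g f K xb yb X Y \<le> ereal (C3 / (real N)\<^sup>2)" .
    qed
  qed
qed

end
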